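(* For every $\alpha\in(0,1]$ there are constants $c_\alpha>0$ and $C_\alpha>0$, depending only on $\alpha$, such that the following holds. Let $\mu$ be a probability distribution on $\binom{[n]}{k}$ whose generating polynomial $g_\mu(z)=\sum_{S\in\binom{[n]}{k}}\mu(S)\prod_{i\in S}z_i$ is $\Gamma_\alpha$-stable, i.e. has no zero on $\Gamma_\alpha^n$. Let $r=\lceil 1/\alpha\rceil$ and suppose $k\ge r$. Then the $k\leftrightarrow k-r$ down-up walk for $\mu$ has modified log-Sobolev constant at least $$c_\alpha\,k^{-1/\alpha}.$$ Consequently, for every $S_0$ in the support of $\mu$ and every $\varepsilon\in(0,1)$, the total variation mixing time of this walk started from the state $S_0$ satisfies $$t_{\mathrm{mix}}(\varepsilon)\le C_\alpha\,k^{1/\alpha}\left(\log\left(1+\log\frac{1}{\mu(S_0)}\right)+\log\frac1\varepsilon\right).$$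
   Context: $[n]=\{1,\dots,n\}$ and $\binom{[n]}{k}$ is the set of $k$-element subsets of $[n]$. For $0<\alpha\le 1$, $\Gamma_\alpha=\{re^{i\theta}: r>0,\ |\theta|<\alpha\pi/2\}\subset\mathbb C$. For $\ell\le k$, the $k\leftrightarrow \ell$ down-up walk for $\mu$ is the Markov chain on the support of $\mu$ which, from its current $k$-set $S$, first chooses a uniformly random $\ell$-subset $T\subseteq S$ and then moves to a random $k$-set $S'\supseteq T$ chosen with probability proportional to $\mu(S')$. It is reversible with stationary distribution $\mu$. For a Markov chain with transition matrix $P$ reversible with respect to $\mu$, let $\mathcal E_P(f,g)=\frac12\sum_{x,y}\mu(x)P(x,y)(f(x)-f(y))(g(x)-g(y))$ and $\operatorname{Ent}_\mu(f)=\mathbb E_\mu[f\log f]-\mathbb E_\mu[f]\log\mathbb E_\mu[f]$. The modified log-Sobolev constant is the largest $\rho$ such that $\mathcal E_P(f,\log f)\ge\rho\operatorname{Ent}_\mu(f)$ for all functions $f$ from the support of $\mu$ to $\mathbb R_{>0}$. The mixing time $t_{\mathrm{mix}}(\varepsilon)$ from $S_0$ is the least integer $t\ge 0$ such that the law of the chain after $t$ steps started from $S_0$ is within total variation distance $\varepsilon$ of $\mu$. *)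

theory Defs
  imports "HOL-Probability.Probability" "HOL-Library.Ramsey"
begin

definition sector :: "real \<Rightarrow> complex set" where
  "sector \<alpha> = {of_real r * cis \<theta> | r \<theta>. 0 < r \<and> \<bar>\<theta>\<bar> < \<alpha> * pi / 2}"

text \<open>The generating polynomial of a distribution on \<open>[{1..n}]\<^bsup>k\<^esup>\<close>, given by its evaluation map
  on \<open>n\<close>-tuples of complex numbers: only the values \<open>z 1, \<dots>, z n\<close> matter.\<close>

definition gen_poly :: "nat \<Rightarrow> nat \<Rightarrow> nat set pmf \<Rightarrow> (nat \<Rightarrow> complex) \<Rightarrow> complex" where
  "gen_poly n k \<mu> z = (\<Sum>S\<in>nsets {1..n} k. of_real (pmf \<mu> S) * (\<Prod>i\<in>S. z i))"

definition stable_on :: "nat \<Rightarrow> complex set \<Rightarrow> ((nat \<Rightarrow> complex) \<Rightarrow> complex) \<Rightarrow> bool" where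
  "stable_on n \<Gamma> g \<longleftrightarrow> (\<forall>z. (\<forall>i\<in>{1..n}. z i \<in> \<Gamma>) \<longrightarrow> g z \<noteq> 0)"

text \<open>A Markov chain is given by its transition kernel; row \<open>x\<close> of the transition matrix is
  \<open>pmf (P x)\<close>. Only the rows of states in the support of the stationary distribution are meaningful.
  In particular, for \<open>S\<close> in the support of \<open>\<mu>\<close> and \<open>T \<subseteq> S\<close> the event conditioned on below
  has positive probability.\<close>

definition down_up_walk :: "nat set pmf \<Rightarrow> nat \<Rightarrow> nat \<Rightarrow> nat set \<Rightarrow> nat set pmf" where
  "down_up_walk \<mu> k l S =
     bind_pmf (pmf_of_set (nsets S l)) (\<lambda>T. cond_pmf \<mu> {S'. card S' = k \<and> T \<subseteq> S'})"

text \<open>For distributions of finite support.\<close>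

definition dirichlet_form ::
  "'a pmf \<Rightarrow> ('a \<Rightarrow> 'a pmf) \<Rightarrow> ('a \<Rightarrow> real) \<Rightarrow> ('a \<Rightarrow> real) \<Rightarrow> real" where
  "dirichlet_form \<mu> P f g =
     (\<Sum>x\<in>set_pmf \<mu>. \<Sum>y\<in>set_pmf \<mu>. pmf \<mu> x * pmf (P x) y * (f x - f y) * (g x - g y)) / 2"

definition entropy_functional :: "'a pmf \<Rightarrow> ('a \<Rightarrow> real) \<Rightarrow> real" where
  "entropy_functional \<mu> f =
     measure_pmf.expectation \<mu> (\<lambda>x. f x * ln (f x))
       - measure_pmf.expectation \<mu> f * ln (measure_pmf.expectation \<mu> f)"

text \<open>The set of admissible \<open>\<rho>\<close> is closed under suprema, so a finite value is the largest admissible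
  \<open>\<rho>\<close>; the value is \<open>\<infinity>\<close> when every \<open>\<rho>\<close> is admissible, i.e. when \<open>\<mu>\<close> is a point mass.\<close>

definition mod_log_sobolev_const :: "'a pmf \<Rightarrow> ('a \<Rightarrow> 'a pmf) \<Rightarrow> ereal" where
  "mod_log_sobolev_const \<mu> P =
     Sup {ereal \<rho> | \<rho>. \<forall>f. (\<forall>x\<in>set_pmf \<mu>. 0 < f x) \<longrightarrow>
            dirichlet_form \<mu> P f (\<lambda>x. ln (f x)) \<ge> \<rho> * entropy_functional \<mu> f}"

definition law_after :: "('a \<Rightarrow> 'a pmf) \<Rightarrow> 'a \<Rightarrow> nat \<Rightarrow> 'a pmf" where
  "law_after P x t = ((\<lambda>\<nu>. bind_pmf \<nu> P) ^^ t) (return_pmf x)"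

definition tv_dist :: "'a pmf \<Rightarrow> 'a pmf \<Rightarrow> real" where
  "tv_dist p q = (SUP A. \<bar>measure_pmf.prob p A - measure_pmf.prob q A\<bar>)"

text \<open>The value is \<open>\<infinity>\<close> if distance \<open>\<epsilon>\<close> is never reached.\<close>

definition mixing_time :: "'a pmf \<Rightarrow> ('a \<Rightarrow> 'a pmf) \<Rightarrow> 'a \<Rightarrow> real \<Rightarrow> enat" where
  "mixing_time \<mu> P x \<epsilon> = Inf {enat t | t. tv_dist (law_after P x t) \<mu> \<le> \<epsilon>}"

end

theory Submission
  imports Defs "HOL-Complex_Analysis.Great_Picard"
begin

text \<open>
  Let \<open>g\<close> be the generating polynomial. The function \<open>H(z) = g(z\<^sup>\<alpha>)\<^bsup>1/(k\<alpha>)\<^esup>\<close> is one-homogeneous and zero-free on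
  the right half plane, hence on all rotated half planes. An induction on the number of variables shows
  that the argument of \<open>g(z\<^sup>\<alpha>)\<close> stays in \<open>[0, k\<alpha>\<pi>]\<close> when all \<open>z\<^sub>i\<close> are in the upper half plane, so \<open>H\<close> maps the
  upper half plane to itself along positive directions, and the maximum principle yields
  \<open>H(z) \<le> \<Sum> p\<^sub>i z\<^sub>i\<close> for positive \<open>z\<close>, where \<open>p\<^sub>i\<close> is \<open>1/k\<close> times the marginal probability of \<open>i\<close>.

  By Gibbs' variational principle this is entropic independence: passing from \<open>k\<close>-sets to a random element
  contracts relative entropy by \<open>1/(\<alpha>k)\<close>. Stability passes to all conditional distributions, so the relative
  entropy not seen by \<open>j\<close>-subsets shrinks, as \<open>j\<close> increases to \<open>j + 1\<close>, by a factor of at least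
  \<open>1 - 1/(\<alpha>(k - j))\<close>. The product of these factors over \<open>j < k - r\<close> is at least a constant times \<open>k\<^bsup>-1/\<alpha>\<^esup>\<close>.
  By Jensen's inequality this bounds the Dirichlet form from below, and also the decay of relative entropy
  in a single step of the walk; the latter gives the mixing time through a Pinsker-type inequality.
\<close>

subsection \<open>Sector-stable homogeneous multiaffine polynomials\<close>

text \<open>The tangent inequality is needed only at the all-ones point: the test vector of entropic
  independence enters as the direction \<open>y\<close>, and conditional distributions are reached
  as links. The obstacle is the root of order k alpha. Zero-freeness gives a logarithm of g only up
  to multiples of 2 pi i, whereas the root is known to land in the closed upper half plane only once
  the imaginary part of that logarithm is known to lie in [0, k alpha pi]. So the induction on the
  variables carries a branch together with this bound, on the upper half plane with the ray [0,
  infinity) attached: on the ray the polynomial is positive, and the branch is pinned to real values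
  there. Branches are identified by one pattern: on a connected set, an imaginary part that vanishes
  at one point and never has modulus pi stays in (-pi, pi). The value of r keeps the contraction
  factors positive, since j < k - r gives k - j > r >= 1 / alpha.\<close>

definition hpoly :: "'a set \<Rightarrow> nat \<Rightarrow> ('a set \<Rightarrow> real) \<Rightarrow> ('a \<Rightarrow> complex) \<Rightarrow> complex" where
  "hpoly I k c z = (\<Sum>S\<in>nsets I k. of_real (c S) * (\<Prod>i\<in>S. z i))"

definition sector_stable :: "real \<Rightarrow> 'a set \<Rightarrow> nat \<Rightarrow> ('a set \<Rightarrow> real) \<Rightarrow> bool" where
  "sector_stable \<alpha> I k c \<longleftrightarrow> (\<forall>z. (\<forall>i\<in>I. z i \<in> sector \<alpha>) \<longrightarrow> hpoly I k c z \<noteq> 0)"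

text \<open>Deleting or contracting a variable can leave the zero polynomial, which the existence
  clause excludes. The total is not normalised to 1, so that both operations stay within the
  class.\<close>

definition weights :: "'a set \<Rightarrow> nat \<Rightarrow> ('a set \<Rightarrow> real) \<Rightarrow> bool" where
  "weights I k c \<longleftrightarrow> (\<forall>S\<in>nsets I k. 0 \<le> c S) \<and> (\<exists>S\<in>nsets I k. 0 < c S)"

lemma sector_stableD:
  "sector_stable \<alpha> I k c \<Longrightarrow> (\<And>i. i \<in> I \<Longrightarrow> z i \<in> sector \<alpha>) \<Longrightarrow> hpoly I k c z \<noteq> 0"
  by (auto simp: sector_stable_def)

lemma nsetsD: "S \<in> nsets I k \<Longrightarrow> i \<in> S \<Longrightarrow> i \<in> I"
  by (auto simp: nsets_def)

lemma nsets_insert: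
  assumes "i \<notin> I"
  shows "nsets (insert i I) (Suc k) = nsets I (Suc k) \<union> insert i ` nsets I k"
proof (intro equalityI subsetI)
  fix S assume S: "S \<in> nsets (insert i I) (Suc k)"
  show "S \<in> nsets I (Suc k) \<union> insert i ` nsets I k"
  proof (cases "i \<in> S")
    case True
    then have "S = insert i (S - {i})" "S - {i} \<in> nsets I k"
      using S by (auto simp: nsets_def)
    then show ?thesis by blast
  next
    case False
    then show ?thesis using S by (auto simp: nsets_def)
  qed
qed (use assms in \<open>auto simp: nsets_def card_insert_if\<close>)

lemma sum_nsets_insert:
  assumes "finite I" "i \<notin> I"
  shows "(\<Sum>S\<in>nsets (insert i I) (Suc k). f S) =
    (\<Sum>S\<in>nsets I (Suc k). f S) + (\<Sum>S\<in>nsets I k. f (insert i S))"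
proof -
  have "inj_on (insert i) (nsets I k)"
    using assms by (auto simp: inj_on_def nsets_def)
  then have "(\<Sum>S\<in>insert i ` nsets I k. f S) = (\<Sum>S\<in>nsets I k. f (insert i S))"
    by (simp add: sum.reindex)
  moreover have "nsets I (Suc k) \<inter> insert i ` nsets I k = {}"
    using assms by (auto simp: nsets_def)
  ultimately show ?thesis
    using assms by (simp add: nsets_insert sum.union_disjoint finite_imp_finite_nsets)
qed

lemma hpoly_insert:
  assumes "finite I" "i \<notin> I"
  shows "hpoly (insert i I) (Suc k) c z =
    hpoly I (Suc k) c z + z i * hpoly I k (\<lambda>S. c (insert i S)) z"
proof -
  have "(\<Prod>j\<in>insert i S. z j) = z i * (\<Prod>j\<in>S. z j)" if "S \<in> nsets I k" for S
    using that assms by (subst prod.insert) (auto simp: nsets_def)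
  then show ?thesis
    using assms by (simp add: hpoly_def sum_nsets_insert sum_distrib_left mult_ac)
qed

lemma hpoly_cong:
  "(\<And>i. i \<in> I \<Longrightarrow> z i = z' i) \<Longrightarrow> hpoly I k c z = hpoly I k c z'"
  unfolding hpoly_def by (intro sum.cong refl arg_cong2[where f="(*)"] prod.cong) (auto dest: nsetsD)

lemma hpoly_scale: "hpoly I k c (\<lambda>i. a * z i) = a ^ k * hpoly I k c z"
proof -
  have "(\<Prod>i\<in>S. a * z i) = a ^ k * (\<Prod>i\<in>S. z i)" if "S \<in> nsets I k" for S
    using that by (simp add: prod.distrib nsets_def)
  then show ?thesis
    by (simp add: hpoly_def sum_distrib_left mult_ac)
qed

lemma hpoly_of_real:
  "hpoly I k c (\<lambda>i. of_real (x i)) = of_real (\<Sum>S\<in>nsets I k. c S * (\<Prod>i\<in>S. x i))"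
  by (simp add: hpoly_def)

lemma sum_coeff_pos:
  fixes x :: "'a \<Rightarrow> real"
  assumes "finite I" "weights I k c" "\<And>i. i \<in> I \<Longrightarrow> 0 < x i"
  shows "0 < (\<Sum>S\<in>nsets I k. c S * (\<Prod>i\<in>S. x i))"
proof -
  obtain S0 where S0: "S0 \<in> nsets I k" "0 < c S0"
    using assms(2) by (auto simp: weights_def)
  have pos: "0 < (\<Prod>i\<in>S. x i)" if "S \<in> nsets I k" for S
    using that assms(3) by (intro prod_pos) (auto dest: nsetsD)
  show ?thesis
  proof (rule sum_pos2[OF finite_imp_finite_nsets[OF assms(1)] S0(1)])
    show "0 < c S0 * (\<Prod>i\<in>S0. x i)"
      using S0 pos by simp
    show "0 \<le> c S * (\<Prod>i\<in>S. x i)" if "S \<in> nsets I k" for S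
      using pos[OF that] assms(2) that by (simp add: weights_def less_imp_le)
  qed
qed

lemma holomorphic_hpoly [holomorphic_intros]:
  assumes "\<And>i. i \<in> I \<Longrightarrow> (\<lambda>s. Z s i) holomorphic_on A"
  shows "(\<lambda>s. hpoly I k c (Z s)) holomorphic_on A"
  unfolding hpoly_def using assms by (intro holomorphic_intros) (auto dest: nsetsD)

lemma continuous_on_hpoly [continuous_intros]:
  assumes "\<And>i. i \<in> I \<Longrightarrow> continuous_on A (\<lambda>s. Z s i)"
  shows "continuous_on A (\<lambda>s. hpoly I k c (Z s))"
  unfolding hpoly_def using assms by (intro continuous_intros) (auto dest: nsetsD)

text \<open>Hurwitz's theorem, applied along the complex powers of a point of the sector: at the
  exponent \<open>0\<close> the limit polynomial is positive.\<close>

lemma sector_stable_limit: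
  assumes "finite I" "0 < \<alpha>" "weights I k c"
    and nz: "\<And>(n::nat) z. (\<And>i. i \<in> I \<Longrightarrow> z i \<in> sector \<alpha>) \<Longrightarrow>
      hpoly I k c z + of_real (1 / Suc n) * hpoly I l c' z \<noteq> 0"
  shows "sector_stable \<alpha> I k c"
  unfolding sector_stable_def
proof (intro allI impI)
  fix z assume z: "\<forall>i\<in>I. z i \<in> sector \<alpha>"
  then have "\<forall>i\<in>I. \<exists>r \<theta>. z i = of_real r * cis \<theta> \<and> 0 < r \<and> \<bar>\<theta>\<bar> < \<alpha> * pi / 2"
    by (auto simp: sector_def)
  then obtain r \<theta> where r\<theta>: "\<And>i. i \<in> I \<Longrightarrow> z i = of_real (r i) * cis (\<theta> i)"
    "\<And>i. i \<in> I \<Longrightarrow> 0 < r i" "\<And>i. i \<in> I \<Longrightarrow> \<bar>\<theta> i\<bar> < \<alpha> * pi / 2"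
    by metis
  \<comment> \<open>The complex exponents s for which every power z_i^s stays in the sector. The
    condition is linear in s, so \<open>A\<close> is star-shaped about 0, and it contains 1.\<close>
  define A where "A = (\<Inter>i\<in>I. {s. \<bar>Re s * \<theta> i + Im s * ln (r i)\<bar> < \<alpha> * pi / 2})"
  define Z where "Z s i = exp (s * Complex (ln (r i)) (\<theta> i))" for s i
  have Z1: "hpoly I k c (Z 1) = hpoly I k c z"
    using r\<theta> by (intro hpoly_cong) (simp add: Z_def exp_eq_polar exp_of_real[symmetric])
  have Zsec: "Z s i \<in> sector \<alpha>" if "s \<in> A" "i \<in> I" for s i
  proof -
    have "Z s i = of_real (exp (Re s * ln (r i) - Im s * \<theta> i)) * cis (Re s * \<theta> i + Im s * ln (r i))"
      by (simp add: Z_def exp_eq_polar)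
    then show ?thesis
      using that unfolding sector_def A_def by fastforce
  qed
  have opA: "open A"
    unfolding A_def using \<open>finite I\<close>
    by (intro open_INT) (auto intro!: open_Collect_less continuous_intros)
  have A0: "0 \<in> A" and A1: "1 \<in> A"
    using r\<theta> \<open>0 < \<alpha>\<close> by (auto simp: A_def)
  have "starlike A"
    unfolding starlike_def
  proof (intro bexI[OF _ A0] ballI subsetI)
    fix x y assume x: "x \<in> A" and "y \<in> closed_segment 0 x"
    then obtain u where u: "0 \<le> u" "u \<le> 1" "y = u *\<^sub>R x"
      by (auto simp: in_segment)
    show "y \<in> A"
      unfolding A_def
    proof (intro INT_I CollectI)
      fix i assume "i \<in> I"
      let ?t = "Re x * \<theta> i + Im x * ln (r i)"
      have "Re y * \<theta> i + Im y * ln (r i) = u * ?t"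
        using u by (simp add: algebra_simps)
      moreover have "\<bar>u * ?t\<bar> \<le> \<bar>?t\<bar>"
        using u by (simp add: abs_mult mult_left_le_one_le)
      moreover have "\<bar>?t\<bar> < \<alpha> * pi / 2"
        using x \<open>i \<in> I\<close> by (auto simp: A_def)
      ultimately show "\<bar>Re y * \<theta> i + Im y * ln (r i)\<bar> < \<alpha> * pi / 2"
        by linarith
    qed
  qed
  then have conA: "connected A"
    by (rule starlike_imp_connected)
  define G where "G s = hpoly I k c (Z s)" for s
  define H where "H s = hpoly I l c' (Z s)" for s
  have G0: "G 0 \<noteq> 0"
    using sum_coeff_pos[OF assms(1,3), where x="\<lambda>_. 1"]
    by (simp add: G_def Z_def hpoly_def flip: of_real_sum)
  have holG: "G holomorphic_on A" and holH: "H holomorphic_on A"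
    unfolding G_def H_def Z_def by (intro holomorphic_intros)+
  \<comment> \<open>Hurwitz needs a nonconstant limit function; a constant one keeps its nonzero
    value at 0.\<close>
  have "G 1 \<noteq> 0"
  proof (cases "G constant_on A")
    case True
    then show ?thesis using A0 A1 G0 unfolding constant_on_def by metis
  next
    case False
    show ?thesis
    proof (rule Hurwitz_no_zeros[of A "\<lambda>n s. G s + of_real (1 / Suc n) * H s" G])
      show "open A" "connected A" "1 \<in> A" "\<not> G constant_on A" "G holomorphic_on A"
        by (fact opA conA A1 False holG)+
      show "(\<lambda>s. G s + of_real (1 / Suc n) * H s) holomorphic_on A" for n
        by (intro holomorphic_intros holG holH)
      show "G s + of_real (1 / Suc n) * H s \<noteq> 0" if "s \<in> A" for n s
        unfolding G_def H_def using nz[of "Z s" n] Zsec[OF that] by blast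
      fix K assume K: "compact K" "K \<subseteq> A"
      have "compact (H ` K)"
        using K holH by (intro compact_continuous_image holomorphic_on_imp_continuous_on)
          (auto intro: holomorphic_on_subset)
      then obtain B where B: "0 < B" "\<And>s. s \<in> K \<Longrightarrow> norm (H s) \<le> B"
        using bounded_pos[of "H ` K"] by (auto dest: compact_imp_bounded)
      show "uniform_limit K (\<lambda>n s. G s + of_real (1 / Suc n) * H s) G sequentially"
      proof (rule uniform_limitI)
        fix e :: real assume "0 < e"
        then have "eventually (\<lambda>n. inverse (real (Suc n)) < e / B) sequentially"
          using B by (intro order_tendstoD(2)[OF LIMSEQ_inverse_real_of_nat]) simp
        then show "eventually (\<lambda>n. \<forall>s\<in>K. dist (G s + of_real (1 / Suc n) * H s) (G s) < e) sequentially"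
        proof eventually_elim
          case (elim n)
          show ?case
          proof
            fix s assume "s \<in> K"
            have "dist (G s + of_real (1 / Suc n) * H s) (G s) = inverse (real (Suc n)) * norm (H s)"
              by (simp add: dist_norm norm_mult norm_divide inverse_eq_divide del: of_nat_Suc)
            also have "\<dots> \<le> inverse (real (Suc n)) * B"
              using B(2)[OF \<open>s \<in> K\<close>] by (intro mult_left_mono) auto
            also have "\<dots> < e"
              using elim B(1) by (simp add: field_simps)
            finally show "dist (G s + of_real (1 / Suc n) * H s) (G s) < e" .
          qed
        qed
      qed
    qed
  qed
  then show "hpoly I k c z \<noteq> 0"
    using Z1 by (simp add: G_def)
qed

section \<open>Deletion and contraction of a variable\<close>

lemma of_real_in_sector: "0 < \<alpha> \<Longrightarrow> 0 < x \<Longrightarrow> of_real x \<in> sector \<alpha>"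
  unfolding sector_def by (force intro: exI[of _ "0::real"])

text \<open>Substituting the positive real 1 / (n + 1) for z_i keeps the polynomial zero-free, and
  the limit sets z_i = 0.\<close>

lemma sector_stable_delete:
  assumes st: "sector_stable \<alpha> (insert i I) (Suc k) c" and "finite I" "i \<notin> I" "0 < \<alpha>"
    "weights I (Suc k) c"
  shows "sector_stable \<alpha> I (Suc k) c"
proof (rule sector_stable_limit[OF assms(2,4,5)])
  fix n :: nat and z
  assume z: "\<And>j. j \<in> I \<Longrightarrow> z j \<in> sector \<alpha>"
  let ?z = "z(i := of_real (1 / Suc n))"
  have "hpoly (insert i I) (Suc k) c ?z \<noteq> 0"
    by (rule sector_stableD[OF st])
      (use z of_real_in_sector[OF assms(4), of "1 / Suc n"] in auto)
  moreover have "hpoly I m d ?z = hpoly I m d z" for m d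
    using assms(3) by (intro hpoly_cong) auto
  ultimately show "hpoly I (Suc k) c z + of_real (1 / Suc n) * hpoly I k (\<lambda>S. c (insert i S)) z \<noteq> 0"
    using assms(2,3) by (simp add: hpoly_insert)
qed

text \<open>Substituting n + 1 for z_i and dividing by it isolates, in the limit, the coefficient of
  z_i.\<close>

lemma sector_stable_contract:
  assumes st: "sector_stable \<alpha> (insert i I) (Suc k) c" and "finite I" "i \<notin> I" "0 < \<alpha>"
    "weights I k (\<lambda>S. c (insert i S))"
  shows "sector_stable \<alpha> I k (\<lambda>S. c (insert i S))"
proof (rule sector_stable_limit[OF assms(2,4,5)])
  fix n :: nat and z
  assume z: "\<And>j. j \<in> I \<Longrightarrow> z j \<in> sector \<alpha>"
  let ?z = "z(i := of_real (Suc n))"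
  have "hpoly (insert i I) (Suc k) c ?z \<noteq> 0"
    by (rule sector_stableD[OF st])
      (use z of_real_in_sector[OF assms(4), of "Suc n"] in auto)
  moreover have "hpoly I m d ?z = hpoly I m d z" for m d
    using assms(3) by (intro hpoly_cong) auto
  ultimately have "hpoly I (Suc k) c z + of_real (Suc n) * hpoly I k (\<lambda>S. c (insert i S)) z \<noteq> 0"
    using assms(2,3) by (simp add: hpoly_insert)
  then show "hpoly I k (\<lambda>S. c (insert i S)) z + of_real (1 / Suc n) * hpoly I (Suc k) c z \<noteq> 0"
    by (simp add: field_simps del: of_nat_Suc)
qed

text \<open>By homogeneity, rotating all variables by the angle - alpha pi / 2 multiplies the value
  by a nonzero factor only, and it makes the sector of arguments (0, alpha pi) symmetric.\<close>

lemma hpoly_nonzero_rotated: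
  assumes st: "sector_stable \<alpha> I k c"
    and u: "\<And>i. i \<in> I \<Longrightarrow> \<exists>r \<theta>. u i = of_real r * cis \<theta> \<and> 0 < r \<and> 0 < \<theta> \<and> \<theta> < \<alpha> * pi"
  shows "hpoly I k c u \<noteq> 0"
proof -
  have "hpoly I k c (\<lambda>i. cis (- (\<alpha> * pi / 2)) * u i) \<noteq> 0"
  proof (rule sector_stableD[OF st])
    fix i assume "i \<in> I"
    then obtain r \<theta> where r: "u i = of_real r * cis \<theta>" "0 < r" "0 < \<theta>" "\<theta> < \<alpha> * pi"
      using u by blast
    then have "cis (- (\<alpha> * pi / 2)) * u i = of_real r * cis (\<theta> - \<alpha> * pi / 2)"
      by (simp add: cis_mult mult.left_commute)
    moreover have "\<bar>\<theta> - \<alpha> * pi / 2\<bar> < \<alpha> * pi / 2"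
      using r(3,4) by linarith
    ultimately show "cis (- (\<alpha> * pi / 2)) * u i \<in> sector \<alpha>"
      using r(2) unfolding sector_def by blast
  qed
  then show ?thesis by (simp add: hpoly_scale)
qed

subsection \<open>The argument of a sector-stable polynomial\<close>

definition upper_half :: "complex set" where
  "upper_half = {w. 0 < Im w}"

text \<open>The ray is attached because the logarithms below are real on it, which fixes their
  branch. The negative axis stays out: 1 + w y can vanish there for positive y.\<close>

definition upper_ray :: "complex set" where
  "upper_ray = upper_half \<union> complex_of_real ` {0..}"

definition cpow :: "real \<Rightarrow> complex \<Rightarrow> complex" where
  "cpow \<alpha> u = exp (of_real \<alpha> * Ln u)"

lemma upper_half_subset: "upper_half \<subseteq> upper_ray"
  by (auto simp: upper_ray_def)

lemma upper_ray_cases: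
  assumes "w \<in> upper_ray"
  obtains "0 < Im w" | t where "0 \<le> t" "w = of_real t"
  using assms by (auto simp: upper_ray_def upper_half_def)

lemma connected_upper_ray: "connected upper_ray"
proof (rule connected_intermediate_closure)
  show "connected upper_half"
    by (simp add: upper_half_def convex_connected convex_halfspace_Im_gt)
  show "upper_ray \<subseteq> closure upper_half"
  proof
    fix w assume w: "w \<in> upper_ray"
    have "(\<lambda>n. w + \<i> * of_real (inverse (real (Suc n)))) \<longlonglongrightarrow> w + \<i> * of_real 0"
      by (intro tendsto_intros LIMSEQ_inverse_real_of_nat)
    moreover have "w + \<i> * of_real (inverse (real (Suc n))) \<in> upper_half" for n
    proof -
      have "Im (w + \<i> * of_real r) = Im w + r" for r
        by simp
      moreover have "0 \<le> Im w" using w by (auto simp: upper_half_def upper_ray_def)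
      moreover have "0 < inverse (real (Suc n))" by simp
      ultimately show ?thesis unfolding upper_half_def by (smt (verit) mem_Collect_eq)
    qed
    ultimately show "w \<in> closure upper_half"
      unfolding closure_sequential
      by (intro exI[of _ "\<lambda>n. w + \<i> * of_real (inverse (real (Suc n)))"]) auto
  qed
qed (rule upper_half_subset)

lemma one_plus_upper_ray:
  assumes "w \<in> upper_ray" "0 < y"
  shows "1 + w * of_real y \<notin> \<real>\<^sub>\<le>\<^sub>0"
  using assms(1)
proof (cases rule: upper_ray_cases)
  case 1
  then show ?thesis using assms(2) by (simp add: complex_nonpos_Reals_iff)
next
  case (2 t)
  then have "0 < 1 + t * y" using assms(2) by (simp add: add_pos_nonneg)
  then show ?thesis using 2 by (simp add: complex_nonpos_Reals_iff)
qed

section \<open>Arguments of principal logarithms\<close>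

lemma Im_Ln_one_plus:
  assumes "0 < Im w" "0 < y"
  shows "0 < Im (Ln (1 + w * of_real y))" "Im (Ln (1 + w * of_real y)) < pi"
proof -
  have "0 < Im (1 + w * of_real y)" using assms by simp
  then show "0 < Im (Ln (1 + w * of_real y))" "Im (Ln (1 + w * of_real y)) < pi"
    using Im_Ln_pos_lt_imp[of "1 + w * of_real y"] by auto
qed

lemma Ln_one_plus_real:
  assumes "0 \<le> t" "0 < y"
  shows "Ln (1 + of_real t * of_real y) = of_real (ln (1 + t * y))"
  using assms Ln_of_real[of "1 + t * y"] by (simp add: add_pos_nonneg)

text \<open>The numbers 1 and \<open>exp m\<close> span a cone of opening less than pi, and their
  sum lies in it, so its argument is between theirs.\<close>

lemma Im_Ln_one_plus_exp_nonneg: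
  assumes "0 \<le> Im m" "Im m < pi"
  shows "1 + exp m \<notin> \<real>\<^sub>\<le>\<^sub>0" "0 \<le> Im (Ln (1 + exp m))" "Im (Ln (1 + exp m)) \<le> Im m"
proof -
  have "Im (1 + exp m) \<noteq> 0 \<or> Re (1 + exp m) > 0"
  proof (cases "Im m = 0")
    case True
    then show ?thesis by (simp add: Re_exp add_pos_pos)
  next
    case False
    then have "sin (Im m) > 0" using assms by (intro sin_gt_zero) auto
    then show ?thesis by (simp add: Im_exp)
  qed
  then show nonpos: "1 + exp m \<notin> \<real>\<^sub>\<le>\<^sub>0"
    by (auto simp: complex_nonpos_Reals_iff)
  then have nz: "1 + exp m \<noteq> 0" by auto
  have sn: "0 \<le> sin (Im m)" using assms by (intro sin_ge_zero) auto
  then have "0 \<le> Im (1 + exp m)" by (simp add: Im_exp)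
  then show ge0: "0 \<le> Im (Ln (1 + exp m))"
    using Im_Ln_pos_le[OF nz] nonpos
    by (smt (verit) Im_Ln_le_pi mpi_less_Im_Ln nz)
  have lt: "Im (Ln (1 + exp m)) < pi"
    using Im_Ln_eq_pi[OF nz] nonpos Im_Ln_le_pi[OF nz]
    by (force simp: complex_nonpos_Reals_iff)
  \<comment> \<open>Otherwise (1 + exp m) / exp m would have positive imaginary part, but it equals
    1 + exp (- m).\<close>
  show "Im (Ln (1 + exp m)) \<le> Im m"
  proof (rule ccontr)
    assume "\<not> ?thesis"
    then have "0 < sin (Im (Ln (1 + exp m) - m))"
      using lt assms ge0 by (intro sin_gt_zero) auto
    moreover have "exp (Ln (1 + exp m) - m) = 1 + exp (- m)"
      using nz by (simp add: exp_diff exp_minus field_simps)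
    then have "Im (exp (Ln (1 + exp m) - m)) \<le> 0"
      using sn by (simp add: Im_exp)
    ultimately show False
      by (simp add: Im_exp mult_le_0_iff)
  qed
qed

lemma Im_Ln_one_plus_exp:
  assumes "\<bar>Im m\<bar> < pi"
  shows "1 + exp m \<notin> \<real>\<^sub>\<le>\<^sub>0" "min 0 (Im m) \<le> Im (Ln (1 + exp m))" "Im (Ln (1 + exp m)) \<le> max 0 (Im m)"
proof -
  have "1 + exp m \<notin> \<real>\<^sub>\<le>\<^sub>0 \<and> min 0 (Im m) \<le> Im (Ln (1 + exp m)) \<and> Im (Ln (1 + exp m)) \<le> max 0 (Im m)"
  proof (cases "0 \<le> Im m")
    case True
    then show ?thesis using Im_Ln_one_plus_exp_nonneg[of m] assms by auto
  next
    case False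
    have "0 \<le> Im (cnj m)" "Im (cnj m) < pi" using False assms by auto
    note * = Im_Ln_one_plus_exp_nonneg[OF this]
    have np: "1 + exp m \<notin> \<real>\<^sub>\<le>\<^sub>0"
      using *(1) by (simp add: complex_nonpos_Reals_iff Re_exp Im_exp)
    then have "Ln (1 + exp (cnj m)) = cnj (Ln (1 + exp m))"
      using cnj_Ln[of "1 + exp m"] by (simp add: exp_cnj)
    then show ?thesis using np * False by auto
  qed
  then show "1 + exp m \<notin> \<real>\<^sub>\<le>\<^sub>0" "min 0 (Im m) \<le> Im (Ln (1 + exp m))"
    "Im (Ln (1 + exp m)) \<le> max 0 (Im m)" by auto
qed

text \<open>An intermediate value argument that keeps the imaginary part of a continuous logarithm
  in the principal strip and so rules out stray multiples of 2 pi.\<close>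

lemma abs_less_pi_connected:
  fixes h :: "'a::topological_space \<Rightarrow> real"
  assumes "connected A" "continuous_on A h" "a \<in> A" "h a = 0" "x \<in> A"
    and ne: "\<And>x. x \<in> A \<Longrightarrow> \<bar>h x\<bar> \<noteq> pi"
  shows "\<bar>h x\<bar> < pi"
proof (rule ccontr)
  assume *: "\<not> ?thesis"
  have con: "connected (h ` A)"
    using assms by (intro connected_continuous_image)
  have "0 \<in> h ` A" "h x \<in> h ` A" using assms by (auto simp: image_iff)
  then have "pi \<in> h ` A \<or> - pi \<in> h ` A"
    using connectedD_interval[OF con, of 0 "h x" pi] connectedD_interval[OF con, of "h x" 0 "-pi"] *
    by (cases "0 \<le> h x") auto
  then obtain w where "w \<in> A" "h w = pi \<or> h w = - pi" by auto
  then show False using ne[of w] by auto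
qed

text \<open>A branch \<open>L\<close> of the logarithm of \<open>g((1 + w y)\<^sup>\<alpha>)\<close> on the upper half plane and the ray \<open>[0, \<infinity>)\<close>.
  The bounds on its imaginary part make \<open>exp (L / (k \<alpha>))\<close> a Pick function.\<close>

definition log_branch ::
  "real \<Rightarrow> 'a set \<Rightarrow> nat \<Rightarrow> ('a set \<Rightarrow> real) \<Rightarrow> ('a \<Rightarrow> real) \<Rightarrow> (complex \<Rightarrow> complex) \<Rightarrow> bool" where
  "log_branch \<alpha> I k c y L \<longleftrightarrow>
     L holomorphic_on upper_half \<and> continuous_on upper_ray L \<and>
     (\<forall>w\<in>upper_ray. exp (L w) = hpoly I k c (\<lambda>i. cpow \<alpha> (1 + w * of_real (y i)))) \<and>
     (\<forall>w\<in>upper_ray. 0 \<le> Im (L w) \<and> Im (L w) \<le> k * \<alpha> * pi) \<and>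
     (\<forall>t\<ge>0. Im (L (of_real t)) = 0)"

text \<open>Write \<open>g = A + z\<^sub>i B\<close>. Rescaling \<open>z\<^sub>i\<close> shows that \<open>z\<^sub>i B / A\<close> never meets the negative real axis, so its
  logarithm \<open>M\<close> has imaginary part in \<open>(-\<pi>, \<pi>)\<close>, and the imaginary part of \<open>ln g = ln A + ln (1 + exp M)\<close>
  lies between those of \<open>ln A\<close> and \<open>ln (z\<^sub>i B)\<close>.\<close>

lemma log_branch_join:
  assumes fin: "finite I" "i \<notin> I" and \<alpha>: "0 < \<alpha>" and y: "\<And>j. j \<in> insert i I \<Longrightarrow> 0 < y j"
    and st: "sector_stable \<alpha> (insert i I) (Suc k) c"
    and LA: "log_branch \<alpha> I (Suc k) c y LA"
    and LB: "log_branch \<alpha> I k (\<lambda>S. c (insert i S)) y LB"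
  shows "\<exists>L. log_branch \<alpha> (insert i I) (Suc k) c y L"
proof -
  define l where "l w = of_real \<alpha> * Ln (1 + w * of_real (y i))" for w
  define M where "M w = LB w + l w - LA w" for w
  define L where "L w = LA w + Ln (1 + exp (M w))" for w
  have yi: "0 < y i" using y by simp
  have conl: "continuous_on upper_ray l"
    unfolding l_def using one_plus_upper_ray[OF _ yi] by (intro continuous_intros) auto
  have holl: "l holomorphic_on upper_half"
    unfolding l_def using one_plus_upper_ray[OF _ yi] upper_half_subset
    by (intro holomorphic_intros) auto
  have l_im: "0 \<le> Im (l w)" "Im (l w) \<le> \<alpha> * pi" if "w \<in> upper_ray" for w
  proof -
    have "0 \<le> Im (Ln (1 + w * of_real (y i))) \<and> Im (Ln (1 + w * of_real (y i))) \<le> pi"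
      using that
    proof (cases rule: upper_ray_cases)
      case 1 then show ?thesis using Im_Ln_one_plus[OF _ yi] by (simp add: less_imp_le)
    next
      case 2 then show ?thesis using Ln_one_plus_real[OF _ yi] by simp
    qed
    then show "0 \<le> Im (l w)" "Im (l w) \<le> \<alpha> * pi" using \<alpha> by (auto simp: l_def)
  qed
  have l_real: "Im (l (of_real t)) = 0" if "0 \<le> t" for t
    using Ln_one_plus_real[OF that yi] by (simp add: l_def)
  have conM: "continuous_on upper_ray M" and holM: "M holomorphic_on upper_half"
    unfolding M_def using LA LB conl holl
    by (auto simp: log_branch_def intro!: continuous_intros holomorphic_intros)
  have M_real: "Im (M (of_real t)) = 0" if "0 \<le> t" for t
    using that LA LB l_real by (simp add: M_def log_branch_def)
  define u where "u w j = cpow \<alpha> (1 + w * of_real (y j))" for w j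
  have expM: "hpoly I k (\<lambda>S. c (insert i S)) (u w) * u w i = exp (M w) * hpoly I (Suc k) c (u w)"
    if "w \<in> upper_ray" for w
  proof -
    have "hpoly I k (\<lambda>S. c (insert i S)) (u w) = exp (LB w)" "hpoly I (Suc k) c (u w) = exp (LA w)"
      using LA LB that unfolding log_branch_def u_def by auto
    moreover have "u w i = exp (l w)" by (simp add: u_def cpow_def l_def)
    moreover have "exp (LB w) * exp (l w) = exp (M w) * exp (LA w)"
      by (simp add: M_def flip: exp_add)
    ultimately show ?thesis by simp
  qed
  have ne_pi: "\<bar>Im (M w)\<bar> \<noteq> pi" if w: "w \<in> upper_ray" for w
    using w
  proof (cases rule: upper_ray_cases)
    case 1
    show ?thesis
    proof
      assume *: "\<bar>Im (M w)\<bar> = pi"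
      define t where "t = exp (Re (M w))"
      have "cos (Im (M w)) = -1" "sin (Im (M w)) = 0"
        using * by (auto simp: abs_if split: if_splits) (metis cos_minus cos_pi minus_minus sin_minus sin_pi neg_equal_0_iff_equal)+
      then have eM: "exp (M w) = - of_real t"
        by (simp add: t_def complex_eq_iff Re_exp Im_exp)
      \<comment> \<open>Now z_i B = - t A. Dividing the i-th coordinate by t > 0 keeps its argument
        and would make A + z_i B vanish.\<close>
      let ?v = "(u w)(i := of_real (1 / t) * u w i)"
      have "hpoly (insert i I) (Suc k) c ?v \<noteq> 0"
      proof (rule hpoly_nonzero_rotated[OF st])
        fix j assume j: "j \<in> insert i I"
        have im: "0 < Im (Ln (1 + w * of_real (y j)))" "Im (Ln (1 + w * of_real (y j))) < pi"
          using Im_Ln_one_plus[OF 1 y[OF j]] by auto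
        have "u w j = of_real (exp (\<alpha> * Re (Ln (1 + w * of_real (y j))))) * cis (\<alpha> * Im (Ln (1 + w * of_real (y j))))"
          by (simp add: u_def cpow_def exp_eq_polar)
        moreover have "0 < (if j = i then 1 / t else 1)" by (simp add: t_def)
        ultimately have "?v j = of_real ((if j = i then 1 / t else 1) * exp (\<alpha> * Re (Ln (1 + w * of_real (y j))))) * cis (\<alpha> * Im (Ln (1 + w * of_real (y j))))"
          "0 < (if j = i then 1 / t else 1) * exp (\<alpha> * Re (Ln (1 + w * of_real (y j))))"
          by auto
        then show "\<exists>r \<theta>. ?v j = of_real r * cis \<theta> \<and> 0 < r \<and> 0 < \<theta> \<and> \<theta> < \<alpha> * pi"
          using im \<alpha> by (metis mult_pos_pos mult_strict_left_mono)
      qed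
      moreover have "hpoly I m d ?v = hpoly I m d (u w)" for m d
        using fin by (intro hpoly_cong) auto
      ultimately have "hpoly I (Suc k) c (u w) + of_real (1 / t) * (hpoly I k (\<lambda>S. c (insert i S)) (u w) * u w i) \<noteq> 0"
        using fin by (simp add: hpoly_insert mult_ac)
      then show False
        using expM[OF w] eM by (simp add: t_def)
    qed
  next
    case (2 t)
    then show ?thesis using M_real by simp
  qed
  have M_im: "\<bar>Im (M w)\<bar> < pi" if w: "w \<in> upper_ray" for w
  proof (rule abs_less_pi_connected[OF connected_upper_ray _ _ _ w])
    show "continuous_on upper_ray (\<lambda>w. Im (M w))"
      by (intro continuous_intros conM)
    show "0 \<in> upper_ray" by (auto simp: upper_ray_def image_iff)
    show "Im (M 0) = 0" using M_real[of 0] by simp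
  qed (rule ne_pi)
  note Ln1 = Im_Ln_one_plus_exp[OF M_im]
  have "log_branch \<alpha> (insert i I) (Suc k) c y L"
    unfolding log_branch_def
  proof (intro conjI ballI allI impI)
    show "L holomorphic_on upper_half"
      unfolding L_def using LA holM Ln1(1) upper_half_subset
      by (auto simp: log_branch_def intro!: holomorphic_intros)
    show "continuous_on upper_ray L"
      unfolding L_def using LA conM Ln1(1)
      by (auto simp: log_branch_def intro!: continuous_intros)
    show "Im (L (of_real t)) = 0" if "0 \<le> t" for t
    proof -
      have "of_real t \<in> upper_ray" using that by (auto simp: upper_ray_def)
      then show ?thesis
        using Ln1(2,3)[of "of_real t"] M_real[OF that] LA that by (simp add: L_def log_branch_def)
    qed
    fix w assume w: "w \<in> upper_ray"
    have bA: "0 \<le> Im (LA w)" "Im (LA w) \<le> Suc k * \<alpha> * pi"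
      and bB: "0 \<le> Im (LB w)" "Im (LB w) \<le> k * \<alpha> * pi"
      using LA LB w unfolding log_branch_def by auto
    have "Im (M w) = Im (LB w) + Im (l w) - Im (LA w)" by (simp add: M_def)
    then show "0 \<le> Im (L w)"
      using Ln1(2)[OF w] bA(1) bB(1) l_im(1)[OF w] unfolding L_def by (auto simp: min_def split: if_splits)
    have "Im (LB w) + Im (l w) \<le> Suc k * \<alpha> * pi"
      using bB l_im(2)[OF w] by (simp add: algebra_simps)
    then show "Im (L w) \<le> Suc k * \<alpha> * pi"
      using Ln1(3)[OF w] bA(2) \<open>Im (M w) = _\<close> unfolding L_def by (auto simp: max_def split: if_splits)
    have "1 + exp (M w) \<noteq> 0" using Ln1(1)[OF w] by auto
    then have "exp (L w) = exp (LA w) + exp (M w) * exp (LA w)"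
      by (simp add: L_def exp_add algebra_simps)
    also have "exp (LA w) = hpoly I (Suc k) c (u w)"
      using LA w unfolding log_branch_def u_def by auto
    finally have "exp (L w) = hpoly (insert i I) (Suc k) c (u w)"
      using expM[OF w] fin by (simp add: hpoly_insert mult.commute)
    then show "exp (L w) = hpoly (insert i I) (Suc k) c (\<lambda>i. cpow \<alpha> (1 + w * of_real (y i)))"
      by (simp add: u_def[abs_def])
  qed
  then show ?thesis by blast
qed

text \<open>Induction on the variables. The two parts of g = A + z_i B cannot both vanish
  identically, but one may. If B does, the branch for A serves unchanged; if A does, the branch for
  B is increased by alpha Ln (1 + w y_i), the logarithm of the factor z_i.\<close>

lemma log_branch_exists:
  assumes "finite I" and \<alpha>: "0 < \<alpha>" and "weights I k c" "sector_stable \<alpha> I k c"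
    and "\<And>i. i \<in> I \<Longrightarrow> 0 < y i"
  shows "\<exists>L. log_branch \<alpha> I k c y L"
  using assms(1,3-)
proof (induction I arbitrary: k c rule: finite_induct)
  have const: "\<exists>L. log_branch \<alpha> I 0 c y L" if "weights I 0 c" for I and c :: "'a set \<Rightarrow> real"
    using that by (intro exI[of _ "\<lambda>_. of_real (ln (c {}))"])
      (auto simp: log_branch_def hpoly_def weights_def exp_of_real)
  {
    case empty
    then have "k = 0" by (auto simp: weights_def nsets_empty_iff split: if_splits)
    then show ?case using const empty by blast
  next
    case (insert i I)
    show ?case
    proof (cases k)
      case 0
      then show ?thesis using const insert.prems by blast
    next
      case (Suc m)
      let ?c = "\<lambda>S. c (insert i S)"
      have st: "sector_stable \<alpha> (insert i I) (Suc m) c" using insert.prems Suc by simp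
      have W: "weights (insert i I) (Suc m) c" using insert.prems Suc by simp
      then have nn: "\<forall>S\<in>nsets I (Suc m). 0 \<le> c S" "\<forall>S\<in>nsets I m. 0 \<le> ?c S"
        and ex: "(\<exists>S\<in>nsets I (Suc m). 0 < c S) \<or> (\<exists>S\<in>nsets I m. 0 < ?c S)"
        using insert.hyps by (auto simp: weights_def nsets_insert)
      have A: "\<exists>L. log_branch \<alpha> I (Suc m) c y L" if "weights I (Suc m) c"
        using insert.IH[OF that] sector_stable_delete[OF st insert.hyps \<alpha> that] insert.prems by auto
      have B: "\<exists>L. log_branch \<alpha> I m ?c y L" if "weights I m ?c"
        using insert.IH[OF that] sector_stable_contract[OF st insert.hyps \<alpha> that] insert.prems by auto
      have yi: "0 < y i" using insert.prems by auto
      consider "weights I (Suc m) c" "weights I m ?c" | "weights I (Suc m) c" "\<not> weights I m ?c"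
        | "\<not> weights I (Suc m) c" "weights I m ?c"
        using nn ex by (auto simp: weights_def)
      then show ?thesis
      proof cases
        case 1
        then show ?thesis
          using log_branch_join[OF insert.hyps \<alpha> _ st] A B insert.prems Suc by blast
      next
        case 2
        then have "hpoly I m ?c z = 0" for z
          using nn(2) by (force simp: hpoly_def weights_def intro!: sum.neutral)
        then have "hpoly (insert i I) (Suc m) c z = hpoly I (Suc m) c z" for z
          using insert.hyps by (simp add: hpoly_insert)
        then show ?thesis using A 2 Suc unfolding log_branch_def by auto
      next
        case 3
        then obtain LB where LB: "log_branch \<alpha> I m ?c y LB" using B by blast
        have "hpoly I (Suc m) c z = 0" for z
          using 3 nn(1) by (force simp: hpoly_def weights_def intro!: sum.neutral)
        then have h: "hpoly (insert i I) (Suc m) c z = z i * hpoly I m ?c z" for z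
          using insert.hyps by (simp add: hpoly_insert)
        define L where "L w = of_real \<alpha> * Ln (1 + w * of_real (y i)) + LB w" for w
        have "log_branch \<alpha> (insert i I) (Suc m) c y L"
          unfolding log_branch_def
        proof (intro conjI ballI allI impI)
          show "L holomorphic_on upper_half"
            unfolding L_def using LB one_plus_upper_ray[OF _ yi] upper_half_subset
            by (auto simp: log_branch_def intro!: holomorphic_intros)
          show "continuous_on upper_ray L"
            unfolding L_def using LB one_plus_upper_ray[OF _ yi]
            by (auto simp: log_branch_def intro!: continuous_intros)
          show "Im (L (of_real t)) = 0" if "0 \<le> t" for t
            using that LB Ln_one_plus_real[OF that yi] by (simp add: L_def log_branch_def)
          fix w assume w: "w \<in> upper_ray"
          show "exp (L w) = hpoly (insert i I) (Suc m) c (\<lambda>i. cpow \<alpha> (1 + w * of_real (y i)))"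
            using LB w by (simp add: L_def log_branch_def exp_add h cpow_def)
          have "0 \<le> Im (Ln (1 + w * of_real (y i))) \<and> Im (Ln (1 + w * of_real (y i))) \<le> pi"
            using w
          proof (cases rule: upper_ray_cases)
            case 1 then show ?thesis using Im_Ln_one_plus[OF _ yi] by (simp add: less_imp_le)
          next
            case 2 then show ?thesis using Ln_one_plus_real[OF _ yi] by simp
          qed
          then have "0 \<le> \<alpha> * Im (Ln (1 + w * of_real (y i)))" "\<alpha> * Im (Ln (1 + w * of_real (y i))) \<le> \<alpha> * pi"
            using \<alpha> by auto
          then show "0 \<le> Im (L w)" "Im (L w) \<le> Suc m * \<alpha> * pi"
            using LB w by (auto simp: L_def log_branch_def algebra_simps)
        qed
        then show ?thesis using Suc by blast
      qed
    qed
  }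
qed

subsection \<open>Fractional log-concavity\<close>

lemma hpoly_cpow:
  assumes "finite I"
  shows "hpoly I k c (\<lambda>i. cpow \<alpha> (u i)) =
    (\<Sum>S\<in>nsets I k. of_real (c S) * exp (\<Sum>i\<in>S. of_real \<alpha> * Ln (u i)))"
  unfolding hpoly_def cpow_def
proof (intro sum.cong refl)
  fix S assume "S \<in> nsets I k"
  then have "finite S" by (auto simp: nsets_def)
  then show "of_real (c S) * (\<Prod>i\<in>S. exp (of_real \<alpha> * Ln (u i))) =
    of_real (c S) * exp (\<Sum>i\<in>S. of_real \<alpha> * Ln (u i))"
    by (simp add: exp_sum)
qed

lemma cpow_of_real: "0 < x \<Longrightarrow> cpow \<alpha> (of_real x) = of_real (x powr \<alpha>)"
  by (simp add: cpow_def Ln_of_real powr_def flip: exp_of_real)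

lemma hpoly_cpow_of_real:
  assumes "\<And>i. i \<in> I \<Longrightarrow> 0 < x i"
  shows "hpoly I k c (\<lambda>i. cpow \<alpha> (of_real (x i))) =
    of_real (\<Sum>S\<in>nsets I k. c S * (\<Prod>i\<in>S. x i powr \<alpha>))"
  unfolding hpoly_of_real[symmetric] using assms by (intro hpoly_cong) (simp add: cpow_of_real)

text \<open>Used twice: with base point 1 and direction y for the behaviour at w = 0, and with base
  point y and direction 1 for the behaviour at infinity.\<close>

lemma hpoly_cpow_deriv:
  assumes "finite I" "\<And>i. i \<in> I \<Longrightarrow> 0 < x i"
  shows "((\<lambda>v. hpoly I k c (\<lambda>i. cpow \<alpha> (of_real (x i) + v * of_real (y i)))) has_field_derivative
    of_real (\<Sum>S\<in>nsets I k. c S * (\<Prod>i\<in>S. x i powr \<alpha>) * (\<Sum>i\<in>S. \<alpha> * y i / x i))) (at 0)"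
proof -
  have "((\<lambda>v. of_real (c S) * exp (\<Sum>i\<in>S. of_real \<alpha> * Ln (of_real (x i) + v * of_real (y i))))
    has_field_derivative of_real (c S * (\<Prod>i\<in>S. x i powr \<alpha>) * (\<Sum>i\<in>S. \<alpha> * y i / x i))) (at 0)"
    if S: "S \<in> nsets I k" for S
  proof -
    have pos: "0 < x i" if "i \<in> S" for i using assms(2) S that by (auto dest: nsetsD)
    have fin: "finite S" using S by (simp add: nsets_def)
    have np: "complex_of_real (x i) \<notin> \<real>\<^sub>\<le>\<^sub>0" if "i \<in> S" for i
      using pos[OF that] by (simp add: complex_nonpos_Reals_iff)
    have "exp (\<Sum>i\<in>S. of_real \<alpha> * Ln (complex_of_real (x i))) = (\<Prod>i\<in>S. of_real (x i powr \<alpha>))"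
      using fin pos cpow_of_real[of _ \<alpha>] by (simp add: exp_sum cpow_def)
    moreover have "((\<lambda>v. \<Sum>i\<in>S. of_real \<alpha> * Ln (of_real (x i) + v * of_real (y i)))
      has_field_derivative (\<Sum>i\<in>S. of_real \<alpha> * of_real (y i) / of_real (x i))) (at 0)"
      using np by (intro DERIV_sum) (auto intro!: derivative_eq_intros simp: divide_inverse mult_ac)
    note DERIV_cmult[OF DERIV_fun_exp[OF this], of "of_real (c S)"]
    ultimately show ?thesis
      by (simp add: mult_ac)
  qed
  then have "((\<lambda>v. \<Sum>S\<in>nsets I k. of_real (c S) * exp (\<Sum>i\<in>S. of_real \<alpha> * Ln (of_real (x i) + v * of_real (y i))))
    has_field_derivative (\<Sum>S\<in>nsets I k. of_real (c S * (\<Prod>i\<in>S. x i powr \<alpha>) * (\<Sum>i\<in>S. \<alpha> * y i / x i)))) (at 0)"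
    by (rule DERIV_sum)
  then show ?thesis
    unfolding hpoly_cpow[OF assms(1)] of_real_sum .
qed

text \<open>This is 1 + w y = w (y + 1 / w) in the coordinate w = exp tau. No multiple of 2 pi
  intervenes: y + 1 / w has argument in (-pi, 0] while tau has imaginary part in [0, pi).\<close>

lemma Ln_one_plus_exp_mult:
  assumes "0 \<le> Im \<tau>" "Im \<tau> < pi" "0 < y"
  shows "Ln (1 + exp \<tau> * of_real y) = \<tau> + Ln (of_real y + exp (- \<tau>))"
proof (rule Ln_unique)
  let ?u = "of_real y + exp (- \<tau>)"
  have s: "0 < sin (Im \<tau>)" if "Im \<tau> \<noteq> 0" using that assms by (intro sin_gt_zero) auto
  have np: "?u \<notin> \<real>\<^sub>\<le>\<^sub>0"
  proof (cases "Im \<tau> = 0")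
    case True
    then show ?thesis using assms by (simp add: complex_nonpos_Reals_iff Re_exp not_le add_pos_pos)
  next
    case False
    then show ?thesis using s by (simp add: complex_nonpos_Reals_iff Im_exp)
  qed
  then have nz: "?u \<noteq> 0" by auto
  show "exp (\<tau> + Ln ?u) = 1 + exp \<tau> * of_real y"
    using nz by (simp add: exp_add exp_minus field_simps)
  have "0 \<le> sin (Im \<tau>)" using assms by (intro sin_ge_zero) auto
  then have "Im ?u \<le> 0" by (simp add: Im_exp)
  then have "Im (Ln ?u) \<le> 0"
    using np nz Im_Ln_pos_lt[OF nz] Im_Ln_eq_pi[OF nz] Im_Ln_le_pi[OF nz]
    by (metis complex_nonpos_Reals_iff dual_order.order_iff_strict linorder_not_less)
  then show "Im (\<tau> + Ln ?u) \<le> pi" using assms by simp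
  show "- pi < Im (\<tau> + Ln ?u)" using assms mpi_less_Im_Ln[OF nz] by simp
qed

text \<open>Fractional log-concavity at the all-ones point, in the form of the tangent inequality for the
  one-homogeneous function \<open>H(y) = g(y\<^sup>\<alpha>)\<^bsup>1/(k\<alpha>)\<^esup>\<close>. Along the ray \<open>w \<mapsto> 1 + w y\<close> it is a Pick function
  \<open>f\<close> with \<open>f w \<sim> H(y) w\<close> at infinity, so that \<open>Im (f w) \<ge> H(y) Im w\<close> by the maximum principle,
  and comparing derivatives at \<open>0\<close> gives \<open>H(y) \<le> f' 0\<close>.\<close>

lemma fractional_log_concave_tangent:
  assumes fin: "finite I" and \<alpha>: "0 < \<alpha>" and k: "0 < k"
    and W: "weights I k c" and st: "sector_stable \<alpha> I k c"
    and y: "\<And>i. i \<in> I \<Longrightarrow> 0 < y i" and c1: "(\<Sum>S\<in>nsets I k. c S) = 1"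
  shows "(\<Sum>S\<in>nsets I k. c S * (\<Prod>i\<in>S. y i powr \<alpha>)) \<le>
    ((\<Sum>S\<in>nsets I k. c S * (\<Sum>i\<in>S. y i)) / k) powr (k * \<alpha>)"
proof -
  define d where "d = k * \<alpha>"
  have d: "0 < d" using k \<alpha> by (simp add: d_def)
  define Q0 where "Q0 = (\<Sum>S\<in>nsets I k. c S * (\<Prod>i\<in>S. y i powr \<alpha>))"
  define a where "a = (\<Sum>S\<in>nsets I k. c S * (\<Sum>i\<in>S. y i)) / k"
  define b where "b = Q0 powr (1 / d)"
  have Q0: "0 < Q0"
    unfolding Q0_def by (rule sum_coeff_pos[OF fin W]) (use y in force)
  have b: "0 < b" "b = exp (ln Q0 / d)" using Q0 by (auto simp: b_def powr_def)
  obtain L where L: "log_branch \<alpha> I k c y L"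
    using log_branch_exists[OF fin \<alpha> W st] y by blast
  define f where "f w = exp (L w / of_real d)" for w
  define G where "G w = hpoly I k c (\<lambda>i. cpow \<alpha> (1 + w * of_real (y i)))" for w
  \<comment> \<open>Since 1 + w y = w (y + 1 / w), one has G w = w^d Q (1 / w) on the upper half
    plane: \<open>Q\<close> is \<open>G\<close> read near infinity.\<close>
  define Q where "Q v = hpoly I k c (\<lambda>i. cpow \<alpha> (of_real (y i) + v))" for v
  have expL: "exp (L w) = G w" if "w \<in> upper_ray" for w
    using L that by (simp add: log_branch_def G_def)
  have Q_0: "Q 0 = of_real Q0"
    using hpoly_cpow_of_real[of I y k c \<alpha>] y by (simp add: Q_def Q0_def)
  have G_0: "G 0 = 1"
    using hpoly_cpow_of_real[of I "\<lambda>_. 1" k c \<alpha>] c1 by (simp add: G_def)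
  have "d * a = \<alpha> * (\<Sum>S\<in>nsets I k. c S * (\<Sum>i\<in>S. y i))"
    using k by (simp add: d_def a_def)
  then have "(\<Sum>S\<in>nsets I k. c S * (\<Sum>i\<in>S. \<alpha> * y i)) = d * a"
    by (simp add: sum_distrib_left mult_ac)
  then have dG: "(G has_field_derivative of_real (d * a)) (at 0)"
    using hpoly_cpow_deriv[OF fin, of "\<lambda>_. 1" k c \<alpha> y] by (simp add: G_def[abs_def])
  obtain q1 where dQ: "(Q has_field_derivative of_real q1) (at 0)"
    using hpoly_cpow_deriv[OF fin, of y k c \<alpha> "\<lambda>_. 1", OF y]
    unfolding Q_def[abs_def] of_real_1 mult_1_right by blast
  define q where "q v = exp (Ln (Q v) / of_real d)" for v
  have q0: "q 0 = of_real b"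
    using Q0 b by (simp add: q_def Q_0 Ln_of_real flip: exp_of_real of_real_divide)
  \<comment> \<open>The point is that this derivative is real: with v = 1 / w, f w - b w = (q v - b)
    / v far out, so its imaginary part tends to 0 at infinity.\<close>
  obtain q2 where dq: "(q has_field_derivative of_real q2) (at 0)"
  proof
    have "(q has_field_derivative q 0 * (of_real q1 / Q 0 / of_real d)) (at 0)"
      unfolding q_def using dQ Q0 d
      by (auto intro!: derivative_eq_intros simp: Q_0 complex_nonpos_Reals_iff divide_inverse)
    then show "(q has_field_derivative of_real (b * (q1 / Q0 / d))) (at 0)"
      by (simp add: q0 Q_0)
  qed
  define V where "V = (\<Inter>i\<in>I. {v. - y i < Re v})"
  have V: "open V" "0 \<in> V"
    unfolding V_def using fin y by (auto intro!: open_INT open_halfspace_Re_gt)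
  have contQ: "continuous_on V Q"
    unfolding Q_def cpow_def V_def
    by (intro continuous_intros) (auto simp: complex_nonpos_Reals_iff not_le)
  have "open (V \<inter> Q -` {z. 0 < Re z})"
    using contQ V(1) open_halfspace_Re_gt by (rule continuous_open_preimage)
  moreover have "0 \<in> V \<inter> Q -` {z. 0 < Re z}" using V Q_0 Q0 by simp
  ultimately obtain \<rho> where \<rho>: "0 < \<rho>" "ball 0 \<rho> \<subseteq> V \<inter> Q -` {z. 0 < Re z}"
    by (meson openE)
  \<comment> \<open>Both sides are d-th roots of G w, so only the branch is at stake. In the
    coordinate tau = Ln w, \<open>\<Phi>\<close> is the difference of the two logarithms. Its
    exponential is 1, it is real at one real point, and its imaginary part cannot reach modulus pi,
    where the exponential would be negative; hence it is 0.\<close>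
  have far: "f w = w * q (1 / w)" if w: "w \<in> upper_half" "1 / \<rho> < norm w" for w
  proof -
    define X where "X = {\<tau>. - ln \<rho> < Re \<tau>} \<inter> {\<tau>. 0 \<le> Im \<tau>} \<inter> {\<tau>. Im \<tau> < pi}"
    have conX: "connected X"
      unfolding X_def by (intro convex_connected convex_Int convex_halfspace_Re_gt convex_halfspace_Im_ge convex_halfspace_Im_lt)
    have eX: "exp \<tau> \<in> upper_ray" if "\<tau> \<in> X" for \<tau>
    proof (cases "Im \<tau> = 0")
      case True
      then have "exp \<tau> = of_real (exp (Re \<tau>))" by (simp add: exp_eq_polar)
      then show ?thesis by (auto simp: upper_ray_def)
    next
      case False
      then have "0 < sin (Im \<tau>)" using that by (intro sin_gt_zero) (auto simp: X_def)
      then show ?thesis by (simp add: upper_ray_def upper_half_def Im_exp)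
    qed
    have small: "exp (- \<tau>) \<in> ball 0 \<rho>" if "\<tau> \<in> X" for \<tau>
    proof -
      have "exp (- Re \<tau>) < exp (ln \<rho>)" using that by (subst exp_less_cancel_iff) (auto simp: X_def)
      then show ?thesis using \<rho>(1) by simp
    qed
    have Qpos: "0 < Re (Q (exp (- \<tau>)))" if "\<tau> \<in> X" for \<tau>
      using subsetD[OF \<rho>(2) small[OF that]] by simp
    have Gexp: "G (exp \<tau>) = exp (of_real d * \<tau>) * Q (exp (- \<tau>))" if "\<tau> \<in> X" for \<tau>
    proof -
      have "G (exp \<tau>) = hpoly I k c (\<lambda>i. exp (of_real \<alpha> * \<tau>) * cpow \<alpha> (of_real (y i) + exp (- \<tau>)))"
        unfolding G_def using that y
        by (intro hpoly_cong) (simp add: cpow_def Ln_one_plus_exp_mult X_def algebra_simps exp_add)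
      then show ?thesis
        by (simp add: hpoly_scale Q_def d_def mult.assoc flip: exp_of_nat_mult)
    qed
    define \<Phi> where "\<Phi> \<tau> = L (exp \<tau>) - of_real d * \<tau> - Ln (Q (exp (- \<tau>)))" for \<tau>
    have exp\<Phi>: "exp (\<Phi> \<tau>) = 1" if "\<tau> \<in> X" for \<tau>
    proof -
      have "Q (exp (- \<tau>)) \<noteq> 0" using Qpos[OF that] by auto
      then show ?thesis
        using Gexp[OF that] expL[OF eX[OF that]] by (simp add: \<Phi>_def exp_diff)
    qed
    have cont\<Phi>: "continuous_on X \<Phi>"
    proof -
      have "continuous_on X (\<lambda>\<tau>. L (exp \<tau>))"
      proof (rule continuous_on_compose2[of upper_ray L])
        show "continuous_on upper_ray L" using L by (simp add: log_branch_def)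
        show "exp ` X \<subseteq> upper_ray" using eX by blast
      qed (intro continuous_intros)
      moreover have "continuous_on X (\<lambda>\<tau>. Q (exp (- \<tau>)))"
      proof (rule continuous_on_compose2[OF contQ])
        show "(\<lambda>\<tau>. exp (- \<tau>)) ` X \<subseteq> V" using small \<rho>(2) by blast
      qed (intro continuous_intros)
      moreover have "Q (exp (- \<tau>)) \<notin> \<real>\<^sub>\<le>\<^sub>0" if "\<tau> \<in> X" for \<tau>
        using Qpos[OF that] by (auto simp: complex_nonpos_Reals_iff)
      ultimately show ?thesis
        unfolding \<Phi>_def by (intro continuous_intros) auto
    qed
    define t where "t = 1 - ln \<rho>"
    have tX: "of_real t \<in> X" by (simp add: t_def X_def)
    have "Im (\<Phi> (of_real t)) = 0"
    proof -
      have "exp (complex_of_real t) = of_real (exp t)" "exp (- complex_of_real t) = of_real (exp (- t))"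
        by (simp_all add: exp_of_real flip: of_real_minus)
      moreover define r where "r = (\<Sum>S\<in>nsets I k. c S * (\<Prod>i\<in>S. (y i + exp (- t)) powr \<alpha>))"
      have "Q (of_real (exp (- t))) = of_real r"
        unfolding Q_def r_def using hpoly_cpow_of_real[of I "\<lambda>i. y i + exp (- t)" k c \<alpha>] y
        by (simp add: add_pos_pos)
      moreover have "0 < r"
        unfolding r_def
      proof (rule sum_coeff_pos[OF fin W])
        fix i assume "i \<in> I"
        then have "0 < y i + exp (- t)" using y by (simp add: add_pos_pos)
        then show "0 < (y i + exp (- t)) powr \<alpha>" by simp
      qed
      moreover have "Im (L (of_real (exp t))) = 0" using L by (simp add: log_branch_def)
      ultimately show ?thesis
        by (simp add: \<Phi>_def Ln_of_real)
    qed
    moreover have "\<bar>Im (\<Phi> \<tau>)\<bar> \<noteq> pi" if "\<tau> \<in> X" for \<tau>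
    proof
      assume "\<bar>Im (\<Phi> \<tau>)\<bar> = pi"
      then have "cos (Im (\<Phi> \<tau>)) = - 1" by (metis cos_abs_real cos_pi)
      then have "Re (exp (\<Phi> \<tau>)) < 0" by (simp add: Re_exp)
      then show False using exp\<Phi>[OF that] by simp
    qed
    moreover have "continuous_on X (\<lambda>\<tau>. Im (\<Phi> \<tau>))" by (intro continuous_intros cont\<Phi>)
    ultimately have bd: "\<bar>Im (\<Phi> \<tau>)\<bar> < pi" if "\<tau> \<in> X" for \<tau>
      using abs_less_pi_connected[OF conX _ tX _ that, of "\<lambda>\<tau>. Im (\<Phi> \<tau>)"] by blast
    define \<tau> where "\<tau> = Ln w"
    have wnz: "w \<noteq> 0" using w by (auto simp: upper_half_def)
    have e\<tau>: "exp \<tau> = w" using wnz by (simp add: \<tau>_def)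
    have "- ln \<rho> < ln (norm w)"
      using w(2) \<rho>(1) by (subst ln_inverse[symmetric]) (auto simp: inverse_eq_divide intro!: ln_less_cancel_iff[THEN iffD2])
    then have \<tau>X: "\<tau> \<in> X"
      using w(1) wnz Im_Ln_pos_lt_imp[of w] by (auto simp: X_def \<tau>_def upper_half_def)
    have "\<Phi> \<tau> = Ln (exp (\<Phi> \<tau>))"
      using bd[OF \<tau>X] by (intro Ln_exp[symmetric]) (auto simp: abs_less_iff)
    then have "\<Phi> \<tau> = 0" using exp\<Phi>[OF \<tau>X] by simp
    then have "L w = of_real d * \<tau> + Ln (Q (1 / w))"
      using e\<tau> by (simp add: \<Phi>_def exp_minus inverse_eq_divide algebra_simps)
    then show ?thesis
      using d e\<tau> by (simp add: f_def q_def add_divide_distrib exp_add)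
  qed
  have Imf: "0 \<le> Im (f w)" if "w \<in> upper_half" for w
  proof -
    have "0 \<le> Im (L w)" "Im (L w) \<le> d * pi"
      using L that upper_half_subset by (auto simp: log_branch_def d_def)
    then have "0 \<le> Im (L w) / d" "Im (L w) / d \<le> pi"
      using d by (auto simp: field_simps)
    then have "0 \<le> sin (Im (L w) / d)" by (intro sin_ge_zero)
    then show ?thesis by (simp add: f_def Im_exp Im_divide_of_real)
  qed
  have holf: "f holomorphic_on upper_half"
    unfolding f_def using L d by (auto simp: log_branch_def intro!: holomorphic_intros)
  \<comment> \<open>Maximum modulus for exp (i (f w - b w)), whose modulus is exp (b Im w - Im (f
    w)), on the part of a large disc with Im w >= delta. At height delta the exponent is at most b
    delta <= epsilon because Im f >= 0; on the arc it is at most epsilon by \<open>far\<close> and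
    the real derivative of q. Staying above delta avoids the negative axis, where f is not
    controlled.\<close>
  have julia: "b * Im w \<le> Im (f w)" if w: "w \<in> upper_half" for w
  proof (rule field_le_epsilon)
    fix \<epsilon> :: real assume \<epsilon>: "0 < \<epsilon>"
    have "((\<lambda>v. (q v - q 0) / (v - 0)) \<longlongrightarrow> of_real q2) (at 0)"
      using dq by (simp add: has_field_derivative_iff)
    then have "((\<lambda>v. Im ((q v - q 0) / (v - 0))) \<longlongrightarrow> Im (of_real q2)) (at 0)"
      by (rule tendsto_Im)
    then have "eventually (\<lambda>v. dist (Im ((q v - q 0) / (v - 0))) (Im (of_real q2)) < \<epsilon>) (at 0)"
      using \<epsilon> by (rule tendstoD)
    then obtain s where s: "0 < s" "\<And>v. v \<noteq> 0 \<Longrightarrow> norm v < s \<Longrightarrow> \<bar>Im ((q v - of_real b) / v)\<bar> < \<epsilon>"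
      unfolding eventually_at by (auto simp: q0 dist_norm)
    define \<delta> where "\<delta> = min (Im w) (\<epsilon> / b)"
    have \<delta>: "0 < \<delta>" "\<delta> \<le> Im w" "b * \<delta> \<le> \<epsilon>"
      using w \<epsilon> b(1) by (auto simp: \<delta>_def upper_half_def min_def field_simps)
    define R where "R = norm w + 1 / \<rho> + 1 / s + 1"
    have "0 < 1 / \<rho>" "0 < 1 / s" "0 \<le> norm w" using \<rho>(1) s(1) by auto
    then have R: "norm w \<le> R" "1 / \<rho> < R" "1 / s < R" "0 < R"
      unfolding R_def by linarith+
    define T where "T = cball 0 R \<inter> {w. \<delta> \<le> Im w}"
    have Tsub: "T \<subseteq> upper_half" using \<delta> by (auto simp: T_def upper_half_def)
    have clT: "closed T" unfolding T_def by (intro closed_Int closed_cball closed_halfspace_Im_ge)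
    define E where "E w = exp (\<i> * (f w - of_real b * w))" for w
    have normE: "norm (E w) = exp (b * Im w - Im (f w))" for w
      by (simp add: E_def)
    have holE: "E holomorphic_on upper_half"
      unfolding E_def by (intro holomorphic_intros holf)
    have "norm (E w) \<le> exp \<epsilon>"
    proof (rule maximum_modulus_frontier[of E T])
      show "E holomorphic_on interior T"
        using holE Tsub interior_subset by (meson holomorphic_on_subset order_trans)
      show "continuous_on (closure T) E"
        using clT Tsub holE by (metis closure_closed continuous_on_subset holomorphic_on_imp_continuous_on)
      show "bounded T" unfolding T_def by (intro bounded_Int) auto
      show "w \<in> T" using R \<delta> by (simp add: T_def)
      fix z assume z: "z \<in> frontier T"
      then have zT: "z \<in> T" using clT by (simp add: frontier_def closure_closed)
      have zu: "z \<in> upper_half" using zT Tsub by blast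
      have "ball 0 R \<inter> {w. \<delta> < Im w} \<subseteq> interior T"
        by (intro interior_maximal open_Int open_ball open_halfspace_Im_gt) (auto simp: T_def)
      then consider "Im z = \<delta>" | "norm z = R"
        using z zT unfolding frontier_def by (force simp: T_def)
      then have "b * Im z - Im (f z) \<le> \<epsilon>"
      proof cases
        case 1
        then show ?thesis using Imf[OF zu] \<delta> by simp
      next
        case 2
        have znz: "z \<noteq> 0" using 2 R by auto
        have "f z - of_real b * z = (q (1 / z) - of_real b) / (1 / z)"
          using far[OF zu] 2 R by (simp add: algebra_simps)
        moreover have "norm (1 / z) < s"
          using 2 R s(1) by (simp add: norm_divide field_simps)
        ultimately have "\<bar>Im (f z - of_real b * z)\<bar> < \<epsilon>"
          using s(2)[of "1 / z"] znz by simp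
        then show ?thesis by simp
      qed
      then show "norm (E z) \<le> exp \<epsilon>" by (simp add: normE)
    qed
    then show "b * Im w \<le> Im (f w) + \<epsilon>" by (simp add: normE)
  qed
  \<comment> \<open>\<open>f\<close> is controlled only on one side of 0. The principal logarithm of
    G gives a function that is differentiable at 0 and agrees with f at the points i / (n + 1) once
    Im L < pi there; along these points the bound on Im f becomes a bound on the derivative.\<close>
  define g where "g v = exp (Ln (G v) / of_real d)" for v
  have g0: "g 0 = 1" by (simp add: g_def G_0)
  have "(g has_field_derivative g 0 * (of_real (d * a) / G 0 / of_real d)) (at 0)"
    unfolding g_def using dG d
    by (auto intro!: derivative_eq_intros simp: G_0 divide_inverse)
  then have "(g has_field_derivative of_real a) (at 0)"
    using d by (simp add: g0 G_0)
  then have lim: "((\<lambda>v. (g v - 1) / v) \<longlongrightarrow> of_real a) (at 0)"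
    by (simp add: has_field_derivative_iff g0)
  define h where "h n = \<i> * of_real (inverse (real (Suc n)))" for n
  have h: "h \<longlonglongrightarrow> 0"
    using tendsto_mult[OF tendsto_const tendsto_of_real[OF LIMSEQ_inverse_real_of_nat], of \<i>]
    by (simp add: h_def[abs_def])
  have hu: "h n \<in> upper_half" "h n \<noteq> 0" for n
    by (auto simp: h_def upper_half_def simp del: of_nat_Suc)
  have "filterlim h (at 0) sequentially"
    using h hu by (auto simp: filterlim_at)
  then have lim2: "(\<lambda>n. Re ((g (h n) - 1) / h n)) \<longlonglongrightarrow> a"
    using tendsto_Re[OF filterlim_compose[OF lim]] by simp
  have "(\<lambda>n. L (h n)) \<longlonglongrightarrow> L 0"
  proof (rule continuous_on_tendsto_compose[OF _ h])
    show "continuous_on upper_ray L" using L by (simp add: log_branch_def)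
    show "0 \<in> upper_ray" by (auto simp: upper_ray_def image_iff)
    show "eventually (\<lambda>n. h n \<in> upper_ray) sequentially" using hu upper_half_subset by (intro always_eventually) auto
  qed
  then have "(\<lambda>n. Im (L (h n))) \<longlonglongrightarrow> 0"
    using L tendsto_Im by (fastforce simp: log_branch_def)
  then have "eventually (\<lambda>n. Im (L (h n)) < pi) sequentially"
    by (intro order_tendstoD(2)) auto
  then have "eventually (\<lambda>n. b \<le> Re ((g (h n) - 1) / h n)) sequentially"
  proof eventually_elim
    case (elim n)
    have hr: "h n \<in> upper_ray" using hu upper_half_subset by blast
    have "0 \<le> Im (L (h n))" using L hr by (simp add: log_branch_def)
    then have "Ln (exp (L (h n))) = L (h n)"
      using elim by (intro Ln_exp) (auto intro: less_le_trans[of _ 0])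
    then have gf: "g (h n) = f (h n)"
      using expL[OF hr] by (simp add: g_def f_def)
    have "(g (h n) - 1) / h n = of_real (real (Suc n)) * (- \<i> * (g (h n) - 1))"
      by (simp add: h_def divide_inverse del: of_nat_Suc)
    then have "Re ((g (h n) - 1) / h n) = real (Suc n) * Im (f (h n))"
      by (rule ssubst) (simp add: gf del: of_nat_Suc)
    moreover have "Im (\<i> * of_real r) = r" for r by simp
    then have "b * inverse (real (Suc n)) \<le> Im (f (h n))"
      using julia[OF hu(1), of n] unfolding h_def by metis
    ultimately show ?case
      by (simp add: field_simps del: of_nat_Suc)
  qed
  then have "b \<le> a"
    using lim2 tendsto_lowerbound trivial_limit_sequentially by blast
  then have "b powr d \<le> a powr d"
    using b(1) d by (intro powr_mono2) auto
  moreover have "b powr d = Q0"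
    using Q0 d by (simp add: b_def powr_powr)
  ultimately show ?thesis by (simp add: Q0_def a_def d_def)
qed

text \<open>The ratios of marginals inserted later vanish at elements without mass under the tilted
  weights, so zero entries must be allowed. They come from shifting all entries by delta and letting
  delta tend to 0.\<close>

lemma fractional_log_concave_tangent_nonneg:
  assumes fin: "finite I" and \<alpha>: "0 < \<alpha>" and k: "0 < k"
    and W: "weights I k c" and st: "sector_stable \<alpha> I k c"
    and y: "\<And>i. i \<in> I \<Longrightarrow> 0 \<le> y i" and c1: "(\<Sum>S\<in>nsets I k. c S) = 1"
  shows "(\<Sum>S\<in>nsets I k. c S * (\<Prod>i\<in>S. y i powr \<alpha>)) \<le>
    ((\<Sum>S\<in>nsets I k. c S * (\<Sum>i\<in>S. y i)) / k) powr (k * \<alpha>)" (is "?l \<le> ?a powr _")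
proof -
  have c0: "0 \<le> c S" if "S \<in> nsets I k" for S using W that by (simp add: weights_def)
  have a0: "0 \<le> ?a"
    using c0 y by (intro divide_nonneg_nonneg sum_nonneg mult_nonneg_nonneg) (auto dest: nsetsD)
  have *: "?l \<le> (?a + \<delta>) powr (k * \<alpha>)" if "0 < \<delta>" for \<delta>
  proof -
    have "?l \<le> (\<Sum>S\<in>nsets I k. c S * (\<Prod>i\<in>S. (y i + \<delta>) powr \<alpha>))"
      using c0 y \<alpha> that
      by (intro sum_mono mult_left_mono prod_mono conjI powr_mono2) (auto dest: nsetsD)
    also have "\<dots> \<le> ((\<Sum>S\<in>nsets I k. c S * (\<Sum>i\<in>S. y i + \<delta>)) / k) powr (k * \<alpha>)"
      using y that by (intro fractional_log_concave_tangent[OF fin \<alpha> k W st _ c1]) (auto simp: add_nonneg_pos)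
    also have "(\<Sum>S\<in>nsets I k. c S * (\<Sum>i\<in>S. y i + \<delta>)) = (\<Sum>S\<in>nsets I k. c S * (\<Sum>i\<in>S. y i) + k * \<delta> * c S)"
      by (intro sum.cong refl) (simp add: nsets_def sum.distrib algebra_simps)
    also have "\<dots> = (\<Sum>S\<in>nsets I k. c S * (\<Sum>i\<in>S. y i)) + k * \<delta>"
      using c1 by (simp add: sum.distrib flip: sum_distrib_left)
    finally show ?thesis using k by (simp add: add_divide_distrib)
  qed
  have "(\<lambda>n. (?a + inverse (real (Suc n))) powr (k * \<alpha>)) \<longlonglongrightarrow> (?a + 0) powr (k * \<alpha>)"
  proof (rule tendsto_powr')
    show "(\<lambda>n. ?a + inverse (real (Suc n))) \<longlonglongrightarrow> ?a + 0"
      by (intro tendsto_intros LIMSEQ_inverse_real_of_nat)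
    show "?a + 0 \<noteq> 0 \<or> 0 < real k * \<alpha> \<and> (\<forall>\<^sub>F n in sequentially. 0 \<le> ?a + inverse (real (Suc n)))"
      using k \<alpha> a0 by (intro disjI2 conjI always_eventually allI add_nonneg_nonneg) auto
  qed (rule tendsto_const)
  then have "?l \<le> (?a + 0) powr (k * \<alpha>)"
    by (rule LIMSEQ_le_const) (use * in \<open>auto simp del: of_nat_Suc\<close>)
  then show ?thesis by simp
qed

section \<open>Elementary inequalities for relative entropy\<close>

lemma mult_ln_div_ge:
  fixes a b :: real
  assumes "0 \<le> a" "0 \<le> b" "b = 0 \<Longrightarrow> a = 0"
  shows "a - b \<le> a * ln (a / b)"
proof (cases "a = 0")
  case False
  then have ab: "0 < a" "0 < b" using assms by (auto simp: less_le)
  have "ln (b / a) \<le> b / a - 1" using ab by (intro ln_le_minus_one) simp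
  then have "a * ln (b / a) \<le> b - a" using ab by (simp add: field_simps)
  moreover have "ln (b / a) = - ln (a / b)" using ab by (simp add: ln_div)
  ultimately show ?thesis by simp
qed (use assms in simp)

text \<open>The pointwise inequality is applied to a and to b rescaled by r = sum a / sum b; the
  linear terms then cancel in the sum.\<close>

lemma log_sum_inequality:
  fixes a b :: "'a \<Rightarrow> real"
  assumes "finite A" "\<And>x. x \<in> A \<Longrightarrow> 0 \<le> a x" "\<And>x. x \<in> A \<Longrightarrow> 0 \<le> b x"
    "\<And>x. x \<in> A \<Longrightarrow> b x = 0 \<Longrightarrow> a x = 0"
  shows "sum a A * ln (sum a A / sum b A) \<le> (\<Sum>x\<in>A. a x * ln (a x / b x))"
proof (cases "sum a A = 0")
  case True
  then have "\<And>x. x \<in> A \<Longrightarrow> a x = 0" using assms sum_nonneg_eq_0_iff[of A a] by auto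
  then show ?thesis using True by simp
next
  case False
  have "0 \<le> sum a A" "0 \<le> sum b A" using assms by (auto intro: sum_nonneg)
  moreover have "sum b A \<noteq> 0"
    using False assms sum_nonneg_eq_0_iff[of A b] by (metis sum.neutral)
  ultimately have pos: "0 < sum a A" "0 < sum b A" using False by auto
  define r where "r = sum a A / sum b A"
  have r: "0 < r" using pos by (simp add: r_def)
  have "a x * ln r + (a x - r * b x) \<le> a x * ln (a x / b x)" if x: "x \<in> A" for x
  proof (cases "a x = 0")
    case True
    then show ?thesis using assms(3)[OF x] r by simp
  next
    case False
    then have ab: "0 < a x" "0 < b x" using assms x by (auto simp: less_le)
    have "a x - r * b x \<le> a x * ln (a x / (r * b x))"
      using ab r by (intro mult_ln_div_ge) auto
    also have "ln (a x / (r * b x)) = ln (a x / b x) - ln r"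
      using ab r by (simp add: ln_div ln_mult)
    finally show ?thesis by (simp add: algebra_simps)
  qed
  then have "(\<Sum>x\<in>A. a x * ln r + (a x - r * b x)) \<le> (\<Sum>x\<in>A. a x * ln (a x / b x))"
    by (rule sum_mono)
  moreover have "(\<Sum>x\<in>A. a x * ln r + (a x - r * b x)) = sum a A * ln r + (sum a A - r * sum b A)"
    by (simp add: sum.distrib sum_subtractf sum_distrib_left sum_distrib_right)
  ultimately show ?thesis using pos by (simp add: r_def)
qed

subsection \<open>Entropic independence\<close>

text \<open>For a distribution w on k-sets this is the probability of containing T; divided by the
  number of j-subsets of a k-set it is the law of a uniformly random j-subset.\<close>

definition up_mass :: "'a set \<Rightarrow> nat \<Rightarrow> ('a set \<Rightarrow> real) \<Rightarrow> 'a set \<Rightarrow> real" where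
  "up_mass V k w T = (\<Sum>S\<in>{S \<in> nsets V k. T \<subseteq> S}. w S)"

lemma up_mass_empty: "up_mass V k w {} = (\<Sum>S\<in>nsets V k. w S)"
  by (simp add: up_mass_def)

lemma up_mass_nonneg: "\<forall>S\<in>nsets V k. 0 \<le> w S \<Longrightarrow> 0 \<le> up_mass V k w T"
  unfolding up_mass_def by (intro sum_nonneg) auto

lemma up_mass_eq_0_imp:
  assumes "finite V" "\<forall>S\<in>nsets V k. 0 \<le> w S" "up_mass V k w T = 0"
    "S \<in> nsets V k" "T \<subseteq> S"
  shows "w S = 0"
  using assms sum_nonneg_eq_0_iff[of "{S \<in> nsets V k. T \<subseteq> S}" w]
  by (auto simp: up_mass_def finite_imp_finite_nsets)

lemma sum_up_mass:
  assumes "finite V" "finite \<T>"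
  shows "(\<Sum>T\<in>\<T>. g T * up_mass V k w T) = (\<Sum>S\<in>nsets V k. w S * (\<Sum>T\<in>{T\<in>\<T>. T \<subseteq> S}. g T))"
proof -
  have "(\<Sum>T\<in>\<T>. g T * up_mass V k w T) = (\<Sum>T\<in>\<T>. \<Sum>S\<in>nsets V k. if T \<subseteq> S then g T * w S else 0)"
    using assms
    by (auto simp: up_mass_def sum_distrib_left sum.inter_filter finite_imp_finite_nsets intro!: sum.cong)
  also have "\<dots> = (\<Sum>S\<in>nsets V k. \<Sum>T\<in>\<T>. if T \<subseteq> S then g T * w S else 0)"
    by (rule sum.swap)
  also have "\<dots> = (\<Sum>S\<in>nsets V k. w S * (\<Sum>T\<in>{T\<in>\<T>. T \<subseteq> S}. g T))"
    using assms by (intro sum.cong refl) (simp add: sum_distrib_left sum.inter_filter mult.commute if_distrib cong: if_cong)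
  finally show ?thesis .
qed

lemma subsets_of_nset:
  assumes "S \<in> nsets V k"
  shows "{T \<in> nsets V j. T \<subseteq> S} = nsets S j" "card (nsets S j) = k choose j"
  using assms card_nsets[of S j] by (auto simp: nsets_def)

lemma sum_up_mass_level:
  fixes w :: "'a set \<Rightarrow> real"
  assumes "finite V"
  shows "(\<Sum>T\<in>nsets V j. up_mass V k w T) = (k choose j) * (\<Sum>S\<in>nsets V k. w S)"
proof -
  have "(\<Sum>T\<in>nsets V j. up_mass V k w T) = (\<Sum>S\<in>nsets V k. w S * (\<Sum>T\<in>{T\<in>nsets V j. T \<subseteq> S}. (1::real)))"
    using sum_up_mass[OF assms, of "nsets V j" "\<lambda>_. 1" k w] assms by (simp add: finite_imp_finite_nsets)
  also have "\<dots> = (\<Sum>S\<in>nsets V k. real (k choose j) * w S)"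
  proof (intro sum.cong refl)
    fix S assume "S \<in> nsets V k"
    then show "w S * (\<Sum>T\<in>{T\<in>nsets V j. T \<subseteq> S}. (1::real)) = real (k choose j) * w S"
      using subsets_of_nset[of S V k j] by simp
  qed
  finally show ?thesis by (simp add: sum_distrib_left)
qed

lemma sum_up_mass_singleton:
  assumes "finite V"
  shows "(\<Sum>i\<in>V. g i * up_mass V k w {i}) = (\<Sum>S\<in>nsets V k. w S * (\<Sum>i\<in>S. g i))"
proof -
  have "(\<Sum>i\<in>V. g i * up_mass V k w {i}) = (\<Sum>i\<in>V. \<Sum>S\<in>nsets V k. if i \<in> S then g i * w S else 0)"
    using assms
    by (auto simp: up_mass_def sum_distrib_left sum.inter_filter finite_imp_finite_nsets intro!: sum.cong)
  also have "\<dots> = (\<Sum>S\<in>nsets V k. \<Sum>i\<in>V. if i \<in> S then g i * w S else 0)"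
    by (rule sum.swap)
  also have "\<dots> = (\<Sum>S\<in>nsets V k. w S * (\<Sum>i\<in>S. g i))"
  proof (intro sum.cong refl)
    fix S assume "S \<in> nsets V k"
    then have "{i \<in> V. i \<in> S} = S" by (auto dest: nsetsD)
    then show "(\<Sum>i\<in>V. if i \<in> S then g i * w S else 0) = w S * (\<Sum>i\<in>S. g i)"
      using assms by (simp add: sum.inter_filter[symmetric] sum_distrib_left mult.commute)
  qed
  finally show ?thesis .
qed

text \<open>Removing T turns the k-sets containing T into the (k - |T|)-sets of the complement,
  which carries marginals over to the link of T.\<close>

lemma up_mass_union:
  assumes "finite V" "T \<subseteq> V" "card T \<le> k" "U \<inter> T = {}"
  shows "up_mass V k w (T \<union> U) = up_mass (V - T) (k - card T) (\<lambda>S. w (T \<union> S)) U"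
  unfolding up_mass_def
proof (rule sum.reindex_bij_witness[of _ "\<lambda>S. T \<union> S" "\<lambda>S. S - T"])
  have fT: "finite T" using assms finite_subset by blast
  fix S
  assume S: "S \<in> {S \<in> nsets V k. T \<union> U \<subseteq> S}"
  then show "T \<union> (S - T) = S" "w (T \<union> (S - T)) = w S" by (auto intro: arg_cong[where f=w])
  show "S - T \<in> {S \<in> nsets (V - T) (k - card T). U \<subseteq> S}"
    using S assms fT by (auto simp: nsets_def card_Diff_subset)
next
  have fT: "finite T" using assms finite_subset by blast
  fix S
  assume S: "S \<in> {S \<in> nsets (V - T) (k - card T). U \<subseteq> S}"
  then show "T \<union> S - T = S" by (auto simp: nsets_def)
  have "T \<inter> S = {}" "finite S" using S by (auto simp: nsets_def)
  then show "T \<union> S \<in> {S \<in> nsets V k. T \<union> U \<subseteq> S}"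
    using S assms fT by (auto simp: nsets_def card_Un_disjoint)
qed

text \<open>Entropic independence: the Gibbs variational principle with the test function
  \<open>S \<mapsto> \<alpha> (\<Sum>i\<in>S. ln (z i))\<close>, where \<open>z i\<close> is the ratio of the two marginals at \<open>i\<close>.\<close>

lemma entropic_independence:
  assumes fin: "finite V" and \<alpha>: "0 < \<alpha>" and k: "0 < k"
    and W: "weights V k m" and st: "sector_stable \<alpha> V k m"
    and f: "\<And>S. S \<in> nsets V k \<Longrightarrow> 0 \<le> f S"
  defines "M \<equiv> up_mass V k m" and "F \<equiv> up_mass V k (\<lambda>S. m S * f S)"
  shows "\<alpha> * ((\<Sum>i\<in>V. F {i} * ln (F {i} / M {i})) - k * (F {} * ln (F {} / M {})))
    \<le> (\<Sum>S\<in>nsets V k. m S * f S * ln (f S)) - F {} * ln (F {} / M {})"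
proof (cases "F {} = 0")
  case True
  have mf: "\<forall>S\<in>nsets V k. 0 \<le> m S * f S"
    using W f by (simp add: weights_def)
  have mf0: "m S * f S = 0" if "S \<in> nsets V k" for S
    using up_mass_eq_0_imp[OF fin mf, where T = "{}"] True that by (simp add: F_def)
  have "F {i} = 0" for i
    unfolding F_def up_mass_def using mf0 by (intro sum.neutral) auto
  moreover have "(\<Sum>S\<in>nsets V k. m S * f S * ln (f S)) = 0"
    using mf0 by (intro sum.neutral) auto
  ultimately show ?thesis using True by simp
next
  case False
  have m0: "\<forall>S\<in>nsets V k. 0 \<le> m S" using W by (simp add: weights_def)
  have mf: "\<forall>S\<in>nsets V k. 0 \<le> m S * f S" using m0 f by simp
  have F0: "0 < F {}"
    using False up_mass_nonneg[OF mf, where T = "{}"] by (simp add: F_def less_le)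
  have M0: "0 < M {}"
    using sum_coeff_pos[OF fin W, where x = "\<lambda>_. 1"] by (simp add: M_def up_mass_empty)
  have Mi0: "0 \<le> M {i}" "0 \<le> F {i}" for i
    unfolding M_def F_def using up_mass_nonneg[OF m0] up_mass_nonneg[OF mf] by blast+
  have FM: "F {i} = 0" if "M {i} = 0" for i
  proof -
    have "m S = 0" if "S \<in> nsets V k" "i \<in> S" for S
      using up_mass_eq_0_imp[OF fin m0, where T = "{i}" and S = S] \<open>M {i} = 0\<close> that by (simp add: M_def)
    then show ?thesis unfolding F_def up_mass_def by (intro sum.neutral) auto
  qed
  define R where "R = F {} / M {}"
  have R: "0 < R" using F0 M0 by (simp add: R_def)
  \<comment> \<open>Division by R makes the c-average of the sum of z over a set equal to k, so the
    right side of the tangent inequality becomes 1.\<close>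
  define z where "z i = F {i} / M {i} / R" for i
  define c where "c S = m S / M {}" for S
  define h where "h S = f S / R" for S
  define g where "g S = (\<Prod>i\<in>S. z i powr \<alpha>)" for S
  have z0: "0 \<le> z i" for i using Mi0 R by (simp add: z_def)
  have c0: "0 \<le> c S" if "S \<in> nsets V k" for S using m0 that M0 by (simp add: c_def)
  have "(\<Sum>S\<in>nsets V k. c S * g S) \<le> ((\<Sum>S\<in>nsets V k. c S * (\<Sum>i\<in>S. z i)) / k) powr (k * \<alpha>)"
    unfolding g_def
  proof (rule fractional_log_concave_tangent_nonneg[OF fin \<alpha> k])
    show "weights V k c" using W M0 unfolding weights_def c_def
      by (meson divide_nonneg_pos divide_pos_pos)
    have "hpoly V k c u = hpoly V k m u / of_real (M {})" for u
      by (simp add: hpoly_def c_def sum_divide_distrib)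
    then show "sector_stable \<alpha> V k c" using st M0 by (simp add: sector_stable_def)
    show "(\<Sum>S\<in>nsets V k. c S) = 1"
      using M0 by (simp add: c_def M_def up_mass_empty flip: sum_divide_distrib)
  qed (rule z0)
  also have "(\<Sum>S\<in>nsets V k. c S * (\<Sum>i\<in>S. z i)) = (\<Sum>S\<in>nsets V k. m S * (\<Sum>i\<in>S. z i)) / M {}"
    by (simp add: c_def sum_divide_distrib)
  also have "(\<Sum>S\<in>nsets V k. m S * (\<Sum>i\<in>S. z i)) = (\<Sum>i\<in>V. z i * M {i})"
    by (simp add: M_def sum_up_mass_singleton[OF fin])
  also have "\<dots> = (\<Sum>i\<in>V. F {i} / R)"
    using FM by (intro sum.cong refl) (auto simp: z_def)
  also have "\<dots> = (\<Sum>i\<in>V. 1 * F {i}) / R"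
    by (simp add: sum_divide_distrib)
  also have "(\<Sum>i\<in>V. 1 * F {i}) = k * F {}"
    unfolding F_def sum_up_mass_singleton[OF fin]
    by (simp add: up_mass_empty sum_distrib_left nsets_def mult_ac cong: sum.cong_simp)
  also have "k * F {} / R / M {} / k = 1"
    using k F0 M0 by (simp add: R_def)
  finally have g1: "(\<Sum>S\<in>nsets V k. c S * g S) \<le> 1" by simp
  \<comment> \<open>So c g has mass at most 1 while c h has mass exactly 1; comparing them term by
    term is the Gibbs inequality.\<close>
  have sum_ch: "(\<Sum>S\<in>nsets V k. c S * h S) = 1"
  proof -
    have "(\<Sum>S\<in>nsets V k. c S * h S) = (\<Sum>S\<in>nsets V k. m S * f S) / (M {} * R)"
      by (simp add: c_def h_def sum_divide_distrib)
    then show ?thesis using M0 F0 by (simp add: R_def F_def up_mass_empty)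
  qed
  \<comment> \<open>Where m f vanishes, c g >= 0 suffices. Elsewhere every z_i with i in S is
    positive, so all logarithms are genuine.\<close>
  have termwise: "c S * h S - c S * g S \<le> (m S * f S * ln (f S) - m S * f S * ln R - m S * f S * (\<Sum>i\<in>S. \<alpha> * ln (z i))) / F {}"
    if S: "S \<in> nsets V k" for S
  proof (cases "m S * f S = 0")
    case True
    have "0 \<le> c S * g S" using c0[OF S] by (simp add: g_def prod_nonneg)
    moreover have "c S * h S = 0" using True by (auto simp: c_def h_def)
    ultimately have le: "c S * h S - c S * g S \<le> 0" by linarith
    have e: "m S * f S * ln (f S) - m S * f S * ln R - m S * f S * (\<Sum>i\<in>S. \<alpha> * ln (z i)) = 0"
      unfolding True by simp
    show ?thesis unfolding e div_0 by (rule le)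
  next
    case False
    then have pos: "0 < m S" "0 < f S" using m0 S f[OF S] by (auto simp: less_le)
    have zpos: "0 < z i" if "i \<in> S" for i
    proof -
      have "F {i} \<noteq> 0" using up_mass_eq_0_imp[OF fin mf, where T = "{i}" and S = S] S that False by (auto simp: F_def)
      moreover then have "M {i} \<noteq> 0" using FM by blast
      ultimately show ?thesis using Mi0[of i] R by (simp add: z_def less_le)
    qed
    have fS: "finite S" using S by (simp add: nsets_def)
    have nz: "z i \<noteq> 0" if "i \<in> S" for i using zpos[OF that] by simp
    have gpos: "0 < g S" unfolding g_def using nz by (intro prod_pos) auto
    have lng: "ln (g S) = (\<Sum>i\<in>S. \<alpha> * ln (z i))"
    proof -
      have "ln (g S) = (\<Sum>i\<in>S. ln (z i powr \<alpha>))"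
        unfolding g_def using fS nz by (intro ln_prod) auto
      then show ?thesis using nz by (simp add: ln_powr)
    qed
    have "h S - g S \<le> h S * ln (h S / g S)"
      using pos R gpos by (intro mult_ln_div_ge) (auto simp: h_def)
    also have "ln (h S / g S) = ln (f S) - ln R - (\<Sum>i\<in>S. \<alpha> * ln (z i))"
      using pos R gpos by (simp add: ln_div ln_mult h_def lng)
    finally have "c S * (h S - g S) \<le> c S * (h S * (ln (f S) - ln R - (\<Sum>i\<in>S. \<alpha> * ln (z i))))"
      using c0[OF S] by (intro mult_left_mono)
    also have "\<dots> = c S * h S * (ln (f S) - ln R - (\<Sum>i\<in>S. \<alpha> * ln (z i)))"
      by simp
    also have "c S * h S = m S * f S / F {}"
      using M0 F0 by (simp add: c_def h_def R_def)
    finally show ?thesis by (simp add: algebra_simps diff_divide_distrib add_divide_distrib)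
  qed
  have "0 \<le> (\<Sum>S\<in>nsets V k. c S * h S - c S * g S)"
    using g1 sum_ch by (simp add: sum_subtractf)
  also have "\<dots> \<le> (\<Sum>S\<in>nsets V k. (m S * f S * ln (f S) - m S * f S * ln R - m S * f S * (\<Sum>i\<in>S. \<alpha> * ln (z i))) / F {})"
    by (rule sum_mono) (rule termwise)
  also have "\<dots> = ((\<Sum>S\<in>nsets V k. m S * f S * ln (f S)) - F {} * ln R - (\<Sum>S\<in>nsets V k. m S * f S * (\<Sum>i\<in>S. \<alpha> * ln (z i)))) / F {}"
    by (simp add: sum_subtractf F_def up_mass_empty sum_distrib_right flip: sum_divide_distrib)
  also have "(\<Sum>S\<in>nsets V k. m S * f S * (\<Sum>i\<in>S. \<alpha> * ln (z i))) = (\<Sum>i\<in>V. \<alpha> * ln (z i) * F {i})"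
    unfolding F_def sum_up_mass_singleton[OF fin] ..
  also have "\<dots> = \<alpha> * (\<Sum>i\<in>V. F {i} * ln (F {i} / M {i}) - F {i} * ln R)"
    unfolding sum_distrib_left
  proof (intro sum.cong refl)
    fix i
    show "\<alpha> * ln (z i) * F {i} = \<alpha> * (F {i} * ln (F {i} / M {i}) - F {i} * ln R)"
    proof (cases "F {i} = 0")
      case False
      then have "0 < F {i} / M {i}" using Mi0[of i] FM[of i] by (auto simp: less_le)
      then have lnz: "ln (z i) = ln (F {i} / M {i}) - ln R"
        unfolding z_def using R by (metis ln_div less_irrefl)
      show ?thesis unfolding lnz by (simp add: algebra_simps)
    qed simp
  qed
  also have "(\<Sum>i\<in>V. F {i} * ln (F {i} / M {i}) - F {i} * ln R) =
    (\<Sum>i\<in>V. F {i} * ln (F {i} / M {i})) - (\<Sum>i\<in>V. 1 * F {i}) * ln R"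
    by (simp add: sum_subtractf sum_distrib_right)
  also have "(\<Sum>i\<in>V. 1 * F {i}) = k * F {}"
    unfolding F_def sum_up_mass_singleton[OF fin]
    by (simp add: up_mass_empty sum_distrib_left nsets_def mult_ac cong: sum.cong_simp)
  finally show ?thesis
    using F0 by (simp add: zero_le_divide_iff R_def algebra_simps)
qed

subsection \<open>Local-to-global entropy contraction\<close>

text \<open>The elements of T are contracted one at a time. A set with positive coefficient in the
  final link also gives one in each intermediate link, so none of these is the zero
  polynomial.\<close>

lemma sector_stable_link:
  assumes "finite V" and \<alpha>: "0 < \<alpha>" and m: "\<forall>S\<in>nsets V k. 0 \<le> m S" and st: "sector_stable \<alpha> V k m"
    and T: "T \<subseteq> V" "card T \<le> k" and W: "weights (V - T) (k - card T) (\<lambda>S. m (T \<union> S))"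
  shows "sector_stable \<alpha> (V - T) (k - card T) (\<lambda>S. m (T \<union> S))"
  using finite_subset[OF T(1) assms(1)] T W
proof (induction T rule: finite_induct)
  case empty
  then show ?case using st by simp
next
  case (insert i T)
  let ?l = "k - card (insert i T)"
  have kT: "k - card T = Suc ?l" using insert.hyps insert.prems(2) by simp
  have V: "V - T = insert i (V - insert i T)" using insert.hyps insert.prems(1) by auto
  have W': "weights (V - T) (k - card T) (\<lambda>S. m (T \<union> S))"
    unfolding weights_def
  proof
    show "\<forall>S\<in>nsets (V - T) (k - card T). 0 \<le> m (T \<union> S)"
    proof
      fix S assume S: "S \<in> nsets (V - T) (k - card T)"
      then have "T \<inter> S = {}" "finite S" by (auto simp: nsets_def)
      then have "T \<union> S \<in> nsets V k"
        using S insert.hyps insert.prems by (auto simp: nsets_def card_Un_disjoint)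
      then show "0 \<le> m (T \<union> S)" using m by blast
    qed
    obtain S where S: "S \<in> nsets (V - insert i T) ?l" "0 < m (insert i T \<union> S)"
      using insert.prems(3) by (auto simp: weights_def)
    have "insert i S \<in> nsets (V - T) (k - card T)"
      unfolding V kT using S(1) by (subst nsets_insert) auto
    moreover have "T \<union> insert i S = insert i T \<union> S" by auto
    ultimately show "\<exists>S\<in>nsets (V - T) (k - card T). 0 < m (T \<union> S)"
      using S(2) by (metis (no_types, lifting))
  qed
  have "sector_stable \<alpha> (insert i (V - insert i T)) (Suc ?l) (\<lambda>S. m (T \<union> S))"
    using insert.IH[OF _ _ W'] insert.prems insert.hyps kT V by auto
  from sector_stable_contract[OF this] show ?case
    using \<alpha> assms(1) insert.prems(3) by simp
qed

lemma link_entropic_independence: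
  assumes fin: "finite V" and \<alpha>: "0 < \<alpha>" and m: "\<forall>S\<in>nsets V k. 0 \<le> m S" and st: "sector_stable \<alpha> V k m"
    and f: "\<forall>S\<in>nsets V k. 0 \<le> f S" and T: "T \<subseteq> V" "card T < k"
  defines "M \<equiv> up_mass V k m" and "F \<equiv> up_mass V k (\<lambda>S. m S * f S)"
  shows "\<alpha> * ((\<Sum>i\<in>V - T. F (insert i T) * ln (F (insert i T) / M (insert i T))) - (k - card T) * (F T * ln (F T / M T)))
    \<le> up_mass V k (\<lambda>S. m S * f S * ln (f S)) T - F T * ln (F T / M T)"
proof (cases "M T = 0")
  \<comment> \<open>A set T without mass has a zero link polynomial, but then every term of the
    claim is 0.\<close>
  case True
  have m0: "m S = 0" if "S \<in> nsets V k" "T \<subseteq> S" for S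
    using up_mass_eq_0_imp[OF fin m, where T = T and S = S] True that by (simp add: M_def)
  have "F (insert i T) = 0" "F T = 0" "up_mass V k (\<lambda>S. m S * f S * ln (f S)) T = 0" for i
    unfolding F_def up_mass_def using m0 by (auto intro!: sum.neutral)
  then show ?thesis by simp
next
  case False
  have nn: "T \<union> S \<in> nsets V k" if "S \<in> nsets (V - T) (k - card T)" for S
  proof -
    have "T \<inter> S = {}" "finite S" "finite T" using that fin T by (auto simp: nsets_def finite_subset)
    then show ?thesis using that T by (auto simp: nsets_def card_Un_disjoint)
  qed
  note U = up_mass_union[OF fin T(1) less_imp_le[OF T(2)]]
  have W: "weights (V - T) (k - card T) (\<lambda>S. m (T \<union> S))"
  proof (rule ccontr)
    assume "\<not> ?thesis"
    then have "\<forall>S\<in>nsets (V - T) (k - card T). m (T \<union> S) = 0"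
      using nn m unfolding weights_def by (metis less_le)
    then have "up_mass V k m (T \<union> {}) = 0"
      by (subst U) (auto simp: up_mass_def)
    then show False using False by (simp add: M_def)
  qed
  have U0: "up_mass V k w T = up_mass (V - T) (k - card T) (\<lambda>S. w (T \<union> S)) {}" for w
    using U[of "{}" w] by simp
  have Ui: "up_mass V k w (insert i T) = up_mass (V - T) (k - card T) (\<lambda>S. w (T \<union> S)) {i}"
    if "i \<in> V - T" for w i
    using U[of "{i}" w] that by simp
  have st': "sector_stable \<alpha> (V - T) (k - card T) (\<lambda>S. m (T \<union> S))"
    using T by (intro sector_stable_link[OF fin \<alpha> m st] W) auto
  show ?thesis
    using entropic_independence[of "V - T" \<alpha> "k - card T" "\<lambda>S. m (T \<union> S)" "\<lambda>S. f (T \<union> S)"] W st' fin \<alpha> T f nn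
    unfolding F_def M_def by (simp add: U0 Ui up_mass_empty cong: sum.cong_simp)
qed

section \<open>Relative entropy seen by j-subsets\<close>

text \<open>Each (j + 1)-set arises once from the removal of each of its j + 1 elements.\<close>

lemma sum_insert_nsets:
  fixes X :: "'a set \<Rightarrow> real"
  assumes "finite V"
  shows "(\<Sum>T\<in>nsets V j. \<Sum>i\<in>V - T. X (insert i T)) = Suc j * (\<Sum>T\<in>nsets V (Suc j). X T)"
proof -
  have "(\<Sum>T\<in>nsets V j. \<Sum>i\<in>V - T. X (insert i T)) =
    (\<Sum>(T, i)\<in>Sigma (nsets V j) (\<lambda>T. V - T). X (insert i T))"
    using assms by (intro sum.Sigma) (auto simp: finite_imp_finite_nsets)
  also have "\<dots> = (\<Sum>(T, i)\<in>Sigma (nsets V (Suc j)) (\<lambda>T. T). X T)"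
    by (rule sum.reindex_bij_witness[of _ "\<lambda>(T, i). (T - {i}, i)" "\<lambda>(T, i). (insert i T, i)"])
      (auto simp: nsets_def insert_absorb)
  also have "\<dots> = (\<Sum>T\<in>nsets V (Suc j). \<Sum>i\<in>T. X T)"
    using assms by (intro sum.Sigma[symmetric]) (auto simp: finite_imp_finite_nsets nsets_def)
  also have "\<dots> = (\<Sum>T\<in>nsets V (Suc j). Suc j * X T)"
    by (intro sum.cong refl) (simp add: nsets_def)
  finally show ?thesis by (simp add: sum_distrib_left)
qed

text \<open>With density f relative to m, this is the relative entropy of the two laws of a
  uniformly random j-subset. The binomial coefficient normalises both laws and cancels inside the
  logarithm. For j = 0 it is the term E f log E f of the entropy functional when m has mass
  1.\<close>

definition level_entropy :: "'a set \<Rightarrow> nat \<Rightarrow> ('a set \<Rightarrow> real) \<Rightarrow> ('a set \<Rightarrow> real) \<Rightarrow> nat \<Rightarrow> real" where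
  "level_entropy V k m f j = (\<Sum>T\<in>nsets V j. up_mass V k (\<lambda>S. m S * f S) T *
     ln (up_mass V k (\<lambda>S. m S * f S) T / up_mass V k m T)) / (k choose j)"

text \<open>Sum the link inequality over all j-sets. Each (j + 1)-set is met j + 1 times and each
  k-set C(k, j) times, and (j + 1) C(k, j + 1) = (k - j) C(k, j) matches the normalisations of the
  two levels.\<close>

lemma level_entropy_step:
  assumes fin: "finite V" and \<alpha>: "0 < \<alpha>" and m: "\<forall>S\<in>nsets V k. 0 \<le> m S" and st: "sector_stable \<alpha> V k m"
    and f: "\<forall>S\<in>nsets V k. 0 \<le> f S" and j: "j < k"
  shows "\<alpha> * (k - j) * (level_entropy V k m f (Suc j) - level_entropy V k m f j)
    \<le> (\<Sum>S\<in>nsets V k. m S * f S * ln (f S)) - level_entropy V k m f j"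
proof -
  define X where "X T = up_mass V k (\<lambda>S. m S * f S) T * ln (up_mass V k (\<lambda>S. m S * f S) T / up_mass V k m T)" for T
  define E where "E = (\<Sum>S\<in>nsets V k. m S * f S * ln (f S))"
  let ?b = "level_entropy V k m f"
  have B: "(\<Sum>T\<in>nsets V i. X T) = (k choose i) * ?b i" if "i \<le> k" for i
    using that by (simp add: level_entropy_def X_def)
  have "(\<Sum>T\<in>nsets V j. \<alpha> * ((\<Sum>i\<in>V - T. X (insert i T)) - (k - j) * X T))
    \<le> (\<Sum>T\<in>nsets V j. up_mass V k (\<lambda>S. m S * f S * ln (f S)) T - X T)"
  proof (rule sum_mono)
    fix T assume "T \<in> nsets V j"
    then have "T \<subseteq> V" "card T = j" by (auto simp: nsets_def)
    then show "\<alpha> * ((\<Sum>i\<in>V - T. X (insert i T)) - (k - j) * X T) \<le> up_mass V k (\<lambda>S. m S * f S * ln (f S)) T - X T"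
      using link_entropic_independence[OF fin \<alpha> m st f, of T] j by (simp add: X_def)
  qed
  then have le: "\<alpha> * (Suc j * (\<Sum>T\<in>nsets V (Suc j). X T) - (k - j) * (\<Sum>T\<in>nsets V j. X T))
    \<le> (k choose j) * E - (\<Sum>T\<in>nsets V j. X T)"
    unfolding sum_subtractf sum_distrib_left[symmetric] sum_insert_nsets[OF fin]
    using sum_up_mass_level[OF fin, where k = k and w = "\<lambda>S. m S * f S * ln (f S)" and j = j] by (simp add: E_def)
  have "Suc j * (k choose Suc j) = (k - j) * (k choose j)"
    using binomial_absorption[of j k] binomial_absorb_comp[of k j] by simp
  then have C: "real (Suc j) * real (k choose Suc j) = real (k - j) * real (k choose j)"
    by (metis of_nat_mult)
  have "Suc j * (\<Sum>T\<in>nsets V (Suc j). X T) = (real (Suc j) * real (k choose Suc j)) * ?b (Suc j)"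
    using B[of "Suc j"] j by simp
  then have S: "Suc j * (\<Sum>T\<in>nsets V (Suc j). X T) = real (k - j) * real (k choose j) * ?b (Suc j)"
    unfolding C .
  have Bj: "(\<Sum>T\<in>nsets V j. X T) = (k choose j) * ?b j"
    using B[of j] j by simp
  have "(k choose j) * (\<alpha> * (k - j) * (?b (Suc j) - ?b j)) \<le> (k choose j) * (E - ?b j)"
    using le unfolding S Bj by (simp only: algebra_simps)
  then show ?thesis
    using j by (simp add: E_def)
qed

lemma level_entropy_0:
  "level_entropy V k m f 0 = (\<Sum>S\<in>nsets V k. m S * f S) * ln ((\<Sum>S\<in>nsets V k. m S * f S) / (\<Sum>S\<in>nsets V k. m S))"
  by (simp add: level_entropy_def up_mass_empty)

lemma level_entropy_0_le:
  assumes fin: "finite V" and m: "\<forall>S\<in>nsets V k. 0 \<le> m S" and f: "\<forall>S\<in>nsets V k. 0 \<le> f S"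
  shows "level_entropy V k m f 0 \<le> (\<Sum>S\<in>nsets V k. m S * f S * ln (f S))"
proof -
  have "level_entropy V k m f 0 \<le> (\<Sum>S\<in>nsets V k. m S * f S * ln (m S * f S / m S))"
    unfolding level_entropy_0 using m f fin
    by (intro log_sum_inequality) (auto simp: finite_imp_finite_nsets)
  also have "\<dots> = (\<Sum>S\<in>nsets V k. m S * f S * ln (f S))"
    by (intro sum.cong refl) simp
  finally show ?thesis .
qed

lemma harm_le_Suc_ln:
  assumes "0 < n"
  shows "harm n \<le> 1 + ln (real n)"
proof -
  obtain l where "n = Suc l" using assms by (cases n) auto
  then show ?thesis
    using decseqD[OF decseq_harm_diff_ln, of 0 l] by (simp add: harm_Suc harm_def)
qed

lemma level_entropy_contraction:
  assumes fin: "finite V" and \<alpha>: "0 < \<alpha>" and m: "\<forall>S\<in>nsets V k. 0 \<le> m S" and st: "sector_stable \<alpha> V k m"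
    and f: "\<forall>S\<in>nsets V k. 0 \<le> f S" and r: "1 / \<alpha> \<le> real r" "r \<le> k"
  shows "exp (- (1 / \<alpha>)) * k powr (- (1 / \<alpha>)) *
      ((\<Sum>S\<in>nsets V k. m S * f S * ln (f S)) - level_entropy V k m f 0)
    \<le> (\<Sum>S\<in>nsets V k. m S * f S * ln (f S)) - level_entropy V k m f (k - r)"
proof -
  define \<beta> where "\<beta> = 1 / \<alpha>"
  define l where "l = k - r"
  define a where "a j = (\<Sum>S\<in>nsets V k. m S * f S * ln (f S)) - level_entropy V k m f j" for j
  have \<beta>: "0 < \<beta>" using \<alpha> by (simp add: \<beta>_def)
  have r0: "0 < r" using r(1) \<alpha> by (cases r) (auto simp: field_simps)
  have a0: "0 \<le> a 0" using level_entropy_0_le[OF fin m f] by (simp add: a_def)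
  \<comment> \<open>With x = k - j, ln (x / (x - beta)) <= beta / (x - beta), and x - beta >= l - j
    because r >= beta. So the factor 1 - beta / x is at least exp (- beta / (l - j)). These
    exponents add up to beta times a harmonic number, at most 1 + ln k; the summand 1 is the origin
    of the constant exp (- 1 / alpha).\<close>
  have step: "exp (- (\<beta> / real (l - j))) * a j \<le> a (Suc j)" if j: "j < l" and aj: "0 \<le> a j" for j
  proof -
    have kj: "real (k - j) = real (l - j) + real r" using j r by (simp add: l_def)
    have lj: "0 < real (l - j)" using j by simp
    define x where "x = real (k - j)"
    have x: "\<beta> < x" "0 < x" "real (l - j) \<le> x - \<beta>"
      using kj lj r(1) \<beta> by (auto simp: x_def \<beta>_def)
    have "ln (x / (x - \<beta>)) \<le> x / (x - \<beta>) - 1"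
      using x by (intro ln_le_minus_one) auto
    also have "\<dots> = \<beta> / (x - \<beta>)" using x by (simp add: field_simps)
    also have "\<dots> \<le> \<beta> / real (l - j)"
      using x lj \<beta> by (intro divide_left_mono) auto
    finally have "- (\<beta> / real (l - j)) \<le> ln ((x - \<beta>) / x)"
      using x by (simp add: ln_div)
    then have "exp (- (\<beta> / real (l - j))) \<le> exp (ln ((x - \<beta>) / x))" by simp
    also have "\<dots> = 1 - \<beta> / x" using x by (simp add: field_simps)
    finally have le: "exp (- (\<beta> / real (l - j))) \<le> 1 - \<beta> / x" .
    have "\<alpha> * x * (a j - a (Suc j)) \<le> a j"
      using level_entropy_step[OF fin \<alpha> m st f, of j] j by (simp add: x_def a_def l_def)
    then have "a j - a (Suc j) \<le> \<beta> / x * a j"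
      using \<alpha> x by (simp add: \<beta>_def field_simps)
    then have "(1 - \<beta> / x) * a j \<le> a (Suc j)" by (simp add: algebra_simps)
    then show ?thesis using mult_right_mono[OF le aj] by linarith
  qed
  have "exp (- (\<Sum>i<j. \<beta> / real (l - i))) * a 0 \<le> a j" if "j \<le> l" for j
    using that
  proof (induction j)
    case (Suc j)
    then have IH: "exp (- (\<Sum>i<j. \<beta> / real (l - i))) * a 0 \<le> a j" and j: "j < l" by auto
    have "0 \<le> a j" using IH a0 by (meson exp_ge_zero mult_nonneg_nonneg order_trans)
    have "exp (- (\<Sum>i<Suc j. \<beta> / real (l - i))) * a 0 =
      exp (- (\<beta> / real (l - j))) * (exp (- (\<Sum>i<j. \<beta> / real (l - i))) * a 0)"
      by (simp add: exp_add exp_diff exp_minus field_simps)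
    also have "\<dots> \<le> exp (- (\<beta> / real (l - j))) * a j"
      using IH by (intro mult_left_mono) auto
    also have "\<dots> \<le> a (Suc j)" using step[OF j \<open>0 \<le> a j\<close>] .
    finally show ?case .
  qed simp
  from this[of l] have main: "exp (- (\<Sum>i<l. \<beta> / real (l - i))) * a 0 \<le> a l" by simp
  have "(\<Sum>i<l. \<beta> / real (l - i)) = \<beta> * (\<Sum>i<l. inverse (real (Suc (l - Suc i))))"
    unfolding sum_distrib_left by (intro sum.cong refl) (auto simp: divide_inverse Suc_diff_Suc)
  also have "\<dots> = \<beta> * harm l"
    using sum.nat_diff_reindex[of "\<lambda>i. inverse (real (Suc i))" l] by (simp add: harm_altdef)
  also have "harm l \<le> 1 + ln (real k)"
  proof (cases "l = 0")
    case True
    then show ?thesis using r r0 by (simp add: harm_def)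
  next
    case False
    then have "harm l \<le> 1 + ln (real l)" by (intro harm_le_Suc_ln) auto
    also have "ln (real l) \<le> ln (real k)" using False by (simp add: l_def)
    finally show ?thesis by simp
  qed
  finally have "- (\<beta> + \<beta> * ln k) \<le> - (\<Sum>i<l. \<beta> / real (l - i))"
    using \<beta> by (simp add: algebra_simps)
  then have "exp (- (\<beta> + \<beta> * ln k)) * a 0 \<le> exp (- (\<Sum>i<l. \<beta> / real (l - i))) * a 0"
    using a0 by (intro mult_right_mono) auto
  moreover have "exp (- (\<beta> + \<beta> * ln k)) = exp (- \<beta>) * k powr (- \<beta>)"
    using r r0 by (simp add: powr_def exp_diff exp_minus exp_add field_simps)
  ultimately show ?thesis using main by (simp add: a_def \<beta>_def l_def)
qed

subsection \<open>The down-up walk\<close>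

lemma up_mass_support:
  assumes "finite V" "set_pmf \<mu> \<subseteq> nsets V k" "\<And>S. S \<notin> set_pmf \<mu> \<Longrightarrow> w S = 0"
  shows "up_mass V k w T = (\<Sum>S\<in>{S \<in> set_pmf \<mu>. T \<subseteq> S}. w S)"
  unfolding up_mass_def using assms
  by (intro sum.mono_neutral_right) (auto simp: finite_imp_finite_nsets)

lemma sum_nsets_support:
  assumes "finite V" "set_pmf \<mu> \<subseteq> nsets V k" "\<And>S. S \<notin> set_pmf \<mu> \<Longrightarrow> w S = 0"
  shows "(\<Sum>S\<in>nsets V k. w S) = (\<Sum>S\<in>set_pmf \<mu>. w S :: real)"
  using assms by (intro sum.mono_neutral_right) (auto simp: finite_imp_finite_nsets)

lemma pmf_eq_0_notin: "S \<notin> set_pmf \<mu> \<Longrightarrow> pmf \<mu> S = 0"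
  by (simp add: set_pmf_iff)

lemma finite_support:
  "finite V \<Longrightarrow> set_pmf \<mu> \<subseteq> nsets V k \<Longrightarrow> finite (set_pmf \<mu>)"
  by (meson finite_imp_finite_nsets finite_subset)

lemma pmf_down_up_walk:
  assumes fin: "finite V" and sub: "set_pmf \<mu> \<subseteq> nsets V k" and x: "x \<in> set_pmf \<mu>" and l: "l \<le> k"
  shows "pmf (down_up_walk \<mu> k l x) y =
    (\<Sum>T\<in>{T\<in>nsets V l. T \<subseteq> x \<and> T \<subseteq> y}. pmf \<mu> y / up_mass V k (pmf \<mu>) T) / (k choose l)"
proof -
  have xk: "x \<in> nsets V k" using x sub by blast
  then have finx: "finite x" "card x = k" "x \<subseteq> V" by (auto simp: nsets_def)
  have fx: "finite (nsets x l)" using finx by (simp add: finite_imp_finite_nsets)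
  have cx: "card (nsets x l) = k choose l" using subsets_of_nset[OF xk] by simp
  then have ne: "nsets x l \<noteq> {}" using l by (metis card.empty binomial_eq_0_iff not_less)
  have cond: "pmf (cond_pmf \<mu> {S'. card S' = k \<and> T \<subseteq> S'}) y =
    (if T \<subseteq> y then pmf \<mu> y / up_mass V k (pmf \<mu>) T else 0)" if T: "T \<in> nsets x l" for T
  proof -
    let ?s = "{S'. card S' = k \<and> T \<subseteq> S'}"
    have "x \<in> set_pmf \<mu> \<inter> ?s" using x T finx by (auto simp: nsets_def)
    then have ne: "set_pmf \<mu> \<inter> ?s \<noteq> {}" by blast
    have "measure_pmf.prob \<mu> ?s = measure_pmf.prob \<mu> (?s \<inter> set_pmf \<mu>)"
      by (rule measure_Int_set_pmf[symmetric])
    also have "?s \<inter> set_pmf \<mu> = {S \<in> set_pmf \<mu>. T \<subseteq> S}" using sub by (auto simp: nsets_def)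
    also have "measure_pmf.prob \<mu> \<dots> = up_mass V k (pmf \<mu>) T"
      using finite_support[OF fin sub]
      by (simp add: measure_measure_pmf_finite up_mass_support[OF fin sub pmf_eq_0_notin])
    finally have "measure_pmf.prob \<mu> ?s = up_mass V k (pmf \<mu>) T" .
    moreover have "pmf \<mu> y = 0" if "card y \<noteq> k"
      using that sub by (intro pmf_eq_0_notin) (auto simp: nsets_def)
    ultimately show ?thesis by (auto simp: pmf_cond[OF ne])
  qed
  have "pmf (down_up_walk \<mu> k l x) y =
    (\<Sum>T\<in>nsets x l. if T \<subseteq> y then pmf \<mu> y / up_mass V k (pmf \<mu>) T else 0) / (k choose l)"
    unfolding down_up_walk_def pmf_bind_pmf_of_set[OF ne fx] cx using cond by simp
  also have "(\<Sum>T\<in>nsets x l. if T \<subseteq> y then pmf \<mu> y / up_mass V k (pmf \<mu>) T else 0) =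
    (\<Sum>T\<in>{T\<in>nsets x l. T \<subseteq> y}. pmf \<mu> y / up_mass V k (pmf \<mu>) T)"
    using fx by (simp add: sum.inter_filter)
  also have "{T\<in>nsets x l. T \<subseteq> y} = {T\<in>nsets V l. T \<subseteq> x \<and> T \<subseteq> y}"
    using finx by (auto simp: nsets_def)
  finally show ?thesis .
qed

section \<open>Dirichlet form and modified log-Sobolev inequality\<close>

text \<open>The double sum is M times the covariance of f and ln f under m / M, and the mean of ln f
  is at most the logarithm of the mean of f.\<close>

lemma covariance_ge_entropy:
  fixes m f :: "'a \<Rightarrow> real"
  assumes "finite A" "\<And>x. x \<in> A \<Longrightarrow> 0 < m x" "\<And>x. x \<in> A \<Longrightarrow> 0 < f x"
  defines "M \<equiv> sum m A" and "F \<equiv> (\<Sum>x\<in>A. m x * f x)"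
  shows "(\<Sum>x\<in>A. m x * f x * ln (f x)) - F * ln (F / M)
    \<le> (\<Sum>x\<in>A. \<Sum>y\<in>A. m x * m y / M * (f x - f y) * (ln (f x) - ln (f y))) / 2"
proof (cases "A = {}")
  case True
  then show ?thesis by (simp add: F_def)
next
  case False
  define g where "g x = ln (f x)" for x
  define G where "G = (\<Sum>x\<in>A. m x * g x)"
  define H where "H = (\<Sum>x\<in>A. m x * f x * g x)"
  have M: "0 < M" unfolding M_def using assms(1,2) False by (intro sum_pos) auto
  have F: "0 < F" unfolding F_def using assms(1-3) False by (intro sum_pos) auto
  have "(\<Sum>x\<in>A. \<Sum>y\<in>A. m x * m y / M * (f x - f y) * (g x - g y)) =
    (\<Sum>x\<in>A. \<Sum>y\<in>A. (m x * f x * g x * m y + m x * (m y * f y * g y) - m x * f x * (m y * g y) - m x * g x * (m y * f y)) / M)"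
    by (intro sum.cong refl) (simp add: algebra_simps add_divide_distrib diff_divide_distrib)
  also have "\<dots> = (\<Sum>x\<in>A. (m x * f x * g x * M + m x * H - m x * f x * G - m x * g x * F) / M)"
    by (simp add: sum.distrib sum_subtractf M_def F_def G_def H_def flip: sum_distrib_left sum_divide_distrib)
  also have "\<dots> = (H * M + M * H - F * G - G * F) / M"
    by (simp add: sum.distrib sum_subtractf M_def F_def G_def H_def flip: sum_distrib_right sum_divide_distrib)
  also have "\<dots> = 2 * (H - F * G / M)"
    using M by (simp add: field_simps)
  finally have *: "(\<Sum>x\<in>A. \<Sum>y\<in>A. m x * m y / M * (f x - f y) * (g x - g y)) / 2 = H - F * G / M"
    by simp
  \<comment> \<open>Jensen's inequality for ln, obtained as the log-sum inequality with numerators m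
    and denominators m f.\<close>
  have "M * ln (M / F) \<le> (\<Sum>x\<in>A. m x * ln (m x / (m x * f x)))"
    unfolding M_def F_def using assms(1-3)
    by (intro log_sum_inequality) (auto simp: less_imp_le dest: assms(2,3))
  also have "\<dots> = - G"
    unfolding G_def sum_negf[symmetric]
  proof (intro sum.cong refl)
    fix x assume x: "x \<in> A"
    have "ln (m x / (m x * f x)) = - g x"
      using assms(2,3)[OF x] by (simp add: g_def ln_div ln_mult)
    then show "m x * ln (m x / (m x * f x)) = - (m x * g x)" by simp
  qed
  finally have "G \<le> M * ln (F / M)" using M F by (simp add: ln_div algebra_simps)
  then have "F * G \<le> F * (M * ln (F / M))" using F by (intro mult_left_mono) auto
  then have "F * G / M \<le> F * ln (F / M)" using M by (simp add: field_simps)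
  then have "H - F * ln (F / M) \<le> H - F * G / M" by simp
  then show ?thesis
    unfolding *[symmetric] unfolding H_def g_def .
qed

text \<open>Given T, both ends of a step are independent draws from the law conditioned on
  containing T. So the form is an average of conditional covariances of f and ln f; each dominates a
  conditional entropy, and together these give the entropy not seen at level l.\<close>

lemma dirichlet_form_ge:
  assumes fin: "finite V" and sub: "set_pmf \<mu> \<subseteq> nsets V k" and l: "l \<le> k"
    and f: "\<forall>x\<in>set_pmf \<mu>. 0 < f x"
  shows "(\<Sum>S\<in>nsets V k. pmf \<mu> S * f S * ln (f S)) - level_entropy V k (pmf \<mu>) f l
    \<le> dirichlet_form \<mu> (down_up_walk \<mu> k l) f (\<lambda>x. ln (f x))"
proof -
  define m where "m = pmf \<mu>"
  define C where "C = real (k choose l)"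
  define A where "A T = {S \<in> set_pmf \<mu>. T \<subseteq> S}" for T
  have C: "0 < C" using l by (simp add: C_def)
  have finA: "finite (A T)" for T using finite_support[OF fin sub] by (simp add: A_def)
  have finl: "finite (nsets V l)" using fin by (simp add: finite_imp_finite_nsets)
  have M: "up_mass V k m T = sum m (A T)" for T
    unfolding A_def m_def by (rule up_mass_support[OF fin sub pmf_eq_0_notin])
  have F: "up_mass V k (\<lambda>S. m S * f S) T = (\<Sum>S\<in>A T. m S * f S)" for T
    unfolding A_def m_def by (rule up_mass_support[OF fin sub]) (simp add: pmf_eq_0_notin)
  have E: "up_mass V k (\<lambda>S. m S * f S * ln (f S)) T = (\<Sum>S\<in>A T. m S * f S * ln (f S))" for T
    unfolding A_def m_def by (rule up_mass_support[OF fin sub]) (simp add: pmf_eq_0_notin)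
  define \<phi> where "\<phi> T x y = m x * m y / sum m (A T) * (f x - f y) * (ln (f x) - ln (f y))" for T x y
  have "dirichlet_form \<mu> (down_up_walk \<mu> k l) f (\<lambda>x. ln (f x)) =
    (\<Sum>x\<in>set_pmf \<mu>. \<Sum>y\<in>set_pmf \<mu>. \<Sum>T\<in>{T\<in>nsets V l. T \<subseteq> x \<and> T \<subseteq> y}. \<phi> T x y / C) / 2"
    unfolding dirichlet_form_def
    by (intro arg_cong2[where f="(/)"] sum.cong refl)
      (simp add: pmf_down_up_walk[OF fin sub _ l] \<phi>_def C_def M[unfolded m_def] m_def
        sum_distrib_left sum_distrib_right sum_divide_distrib mult_ac)
  also have "\<dots> = (\<Sum>x\<in>set_pmf \<mu>. \<Sum>y\<in>set_pmf \<mu>. \<Sum>T\<in>nsets V l. if T \<subseteq> x \<and> T \<subseteq> y then \<phi> T x y / C else 0) / 2"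
    using finl by (simp add: sum.inter_filter)
  also have "\<dots> = (\<Sum>x\<in>set_pmf \<mu>. \<Sum>T\<in>nsets V l. \<Sum>y\<in>set_pmf \<mu>. if T \<subseteq> x \<and> T \<subseteq> y then \<phi> T x y / C else 0) / 2"
    by (intro arg_cong2[where f="(/)"] sum.cong refl sum.swap)
  also have "\<dots> = (\<Sum>T\<in>nsets V l. \<Sum>x\<in>set_pmf \<mu>. \<Sum>y\<in>set_pmf \<mu>. if T \<subseteq> x \<and> T \<subseteq> y then \<phi> T x y / C else 0) / 2"
    by (intro arg_cong2[where f="(/)"] refl sum.swap)
  also have "(\<Sum>T\<in>nsets V l. \<Sum>x\<in>set_pmf \<mu>. \<Sum>y\<in>set_pmf \<mu>. if T \<subseteq> x \<and> T \<subseteq> y then \<phi> T x y / C else 0) =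
    (\<Sum>T\<in>nsets V l. \<Sum>x\<in>A T. \<Sum>y\<in>A T. \<phi> T x y / C)"
  proof (rule sum.cong[OF refl])
    fix T
    have "(\<Sum>x\<in>A T. \<Sum>y\<in>A T. \<phi> T x y / C) =
      (\<Sum>x\<in>set_pmf \<mu>. if T \<subseteq> x then (\<Sum>y\<in>set_pmf \<mu>. if T \<subseteq> y then \<phi> T x y / C else 0) else 0)"
      unfolding A_def using finite_support[OF fin sub] by (simp add: sum.inter_filter)
    also have "\<dots> = (\<Sum>x\<in>set_pmf \<mu>. \<Sum>y\<in>set_pmf \<mu>. if T \<subseteq> x \<and> T \<subseteq> y then \<phi> T x y / C else 0)"
      by (intro sum.cong refl) auto
    finally show "(\<Sum>x\<in>set_pmf \<mu>. \<Sum>y\<in>set_pmf \<mu>. if T \<subseteq> x \<and> T \<subseteq> y then \<phi> T x y / C else 0) =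
      (\<Sum>x\<in>A T. \<Sum>y\<in>A T. \<phi> T x y / C)" by simp
  qed
  also have "\<dots> / 2 = (\<Sum>T\<in>nsets V l. (\<Sum>x\<in>A T. \<Sum>y\<in>A T. \<phi> T x y) / 2) / C"
    by (simp add: sum_divide_distrib mult.commute)
  finally have D: "dirichlet_form \<mu> (down_up_walk \<mu> k l) f (\<lambda>x. ln (f x)) =
    (\<Sum>T\<in>nsets V l. (\<Sum>x\<in>A T. \<Sum>y\<in>A T. \<phi> T x y) / 2) / C" .
  have "(\<Sum>T\<in>nsets V l. up_mass V k (\<lambda>S. m S * f S * ln (f S)) T - up_mass V k (\<lambda>S. m S * f S) T *
      ln (up_mass V k (\<lambda>S. m S * f S) T / up_mass V k m T))
    \<le> (\<Sum>T\<in>nsets V l. (\<Sum>x\<in>A T. \<Sum>y\<in>A T. \<phi> T x y) / 2)"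
  proof (rule sum_mono)
    fix T
    show "up_mass V k (\<lambda>S. m S * f S * ln (f S)) T - up_mass V k (\<lambda>S. m S * f S) T *
        ln (up_mass V k (\<lambda>S. m S * f S) T / up_mass V k m T)
      \<le> (\<Sum>x\<in>A T. \<Sum>y\<in>A T. \<phi> T x y) / 2"
      unfolding M E F \<phi>_def using finA f
      by (intro covariance_ge_entropy) (auto simp: A_def m_def pmf_positive)
  qed
  moreover have "(\<Sum>T\<in>nsets V l. up_mass V k (\<lambda>S. m S * f S * ln (f S)) T - up_mass V k (\<lambda>S. m S * f S) T *
      ln (up_mass V k (\<lambda>S. m S * f S) T / up_mass V k m T)) =
    C * ((\<Sum>S\<in>nsets V k. m S * f S * ln (f S)) - level_entropy V k m f l)"
    using C sum_up_mass_level[OF fin, where k = k and w = "\<lambda>S. m S * f S * ln (f S)" and j = l]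
    by (simp add: sum_subtractf level_entropy_def C_def right_diff_distrib)
  ultimately show ?thesis
    unfolding D using C by (simp add: m_def field_simps)
qed

lemma modified_log_sobolev:
  assumes fin: "finite V" and sub: "set_pmf \<mu> \<subseteq> nsets V k" and \<alpha>: "0 < \<alpha>"
    and st: "sector_stable \<alpha> V k (pmf \<mu>)" and r: "1 / \<alpha> \<le> real r" "r \<le> k"
    and f: "\<forall>x\<in>set_pmf \<mu>. 0 < f x"
  shows "exp (- (1 / \<alpha>)) * k powr (- (1 / \<alpha>)) * entropy_functional \<mu> f
    \<le> dirichlet_form \<mu> (down_up_walk \<mu> k (k - r)) f (\<lambda>x. ln (f x))"
proof -
  \<comment> \<open>f may be negative off the support; the value 1 restores nonnegativity, and the
    measure does not see the change.\<close>
  define f' where "f' S = (if S \<in> set_pmf \<mu> then f S else 1)" for S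
  have f': "\<forall>S\<in>nsets V k. 0 \<le> f' S" using f by (auto simp: f'_def less_imp_le)
  have mf: "pmf \<mu> S * f' S = pmf \<mu> S * f S" for S
    by (simp add: f'_def pmf_eq_0_notin)
  have lf: "level_entropy V k (pmf \<mu>) f' = level_entropy V k (pmf \<mu>) f"
    by (simp add: level_entropy_def mf fun_eq_iff)
  have ef: "(\<Sum>S\<in>nsets V k. pmf \<mu> S * f' S * ln (f' S)) = (\<Sum>S\<in>nsets V k. pmf \<mu> S * f S * ln (f S))"
    by (intro sum.cong refl) (simp add: f'_def pmf_eq_0_notin)
  have ex: "measure_pmf.expectation \<mu> g = (\<Sum>S\<in>nsets V k. pmf \<mu> S * g S)" for g :: "nat set \<Rightarrow> real"
    using integral_measure_pmf_real[of "nsets V k" \<mu> g] sub fin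
    by (simp add: finite_imp_finite_nsets mult.commute subset_iff)
  have "(\<Sum>S\<in>nsets V k. pmf \<mu> S) = 1"
    using fin sub by (intro sum_pmf_eq_1) (simp_all add: finite_imp_finite_nsets)
  then have "entropy_functional \<mu> f = (\<Sum>S\<in>nsets V k. pmf \<mu> S * f S * ln (f S)) - level_entropy V k (pmf \<mu>) f 0"
    by (simp add: entropy_functional_def ex level_entropy_0 mult.assoc)
  then show ?thesis
    using level_entropy_contraction[OF fin \<alpha> _ st f' r] dirichlet_form_ge[OF fin sub _ f, of "k - r"]
    unfolding lf ef by simp
qed

section \<open>Decay of relative entropy in one step\<close>

definition kl_divergence :: "'a pmf \<Rightarrow> 'a pmf \<Rightarrow> real" where
  "kl_divergence \<nu> \<mu> = (\<Sum>x\<in>set_pmf \<mu>. pmf \<nu> x * ln (pmf \<nu> x / pmf \<mu> x))"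

text \<open>The down step brings the relative entropy to that of the l-subsets, where the
  contraction over levels applies. The up step cannot raise it again: the new density averages the
  density on l-subsets, and x ln x is convex.\<close>

lemma kl_divergence_contraction:
  assumes fin: "finite V" and sub: "set_pmf \<mu> \<subseteq> nsets V k" and \<alpha>: "0 < \<alpha>"
    and st: "sector_stable \<alpha> V k (pmf \<mu>)" and r: "1 / \<alpha> \<le> real r" "r \<le> k"
    and \<nu>: "set_pmf \<nu> \<subseteq> set_pmf \<mu>"
  defines "\<nu>' \<equiv> bind_pmf \<nu> (down_up_walk \<mu> k (k - r))"
  shows "set_pmf \<nu>' \<subseteq> set_pmf \<mu>"
    "kl_divergence \<nu>' \<mu> \<le> (1 - exp (- (1 / \<alpha>)) * k powr (- (1 / \<alpha>))) * kl_divergence \<nu> \<mu>"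
proof -
  define m where "m = pmf \<mu>"
  define l where "l = k - r"
  define C where "C = real (k choose l)"
  define h where "h S = pmf \<nu> S / m S" for S
  define F where "F = up_mass V k (\<lambda>S. m S * h S)"
  define M where "M = up_mass V k m"
  have l: "l \<le> k" by (simp add: l_def)
  have C: "0 < C" using l by (simp add: C_def)
  have finl: "finite (nsets V l)" using fin by (simp add: finite_imp_finite_nsets)
  have fins: "finite (set_pmf \<mu>)" by (rule finite_support[OF fin sub])
  have m0: "\<forall>S\<in>nsets V k. 0 \<le> m S" by (simp add: m_def)
  have h0: "\<forall>S\<in>nsets V k. 0 \<le> h S" by (simp add: h_def m_def)
  have mh: "m S * h S = pmf \<nu> S" for S
  proof (cases "S \<in> set_pmf \<mu>")
    case True
    then show ?thesis by (simp add: h_def m_def set_pmf_iff)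
  next
    case False
    then have "S \<notin> set_pmf \<nu>" using \<nu> by blast
    then show ?thesis by (simp add: h_def pmf_eq_0_notin)
  qed
  have mh0: "\<forall>S\<in>nsets V k. 0 \<le> m S * h S" by (simp add: mh)
  have F0: "0 \<le> F T" and M0: "0 \<le> M T" for T
    unfolding F_def M_def using up_mass_nonneg[OF m0] up_mass_nonneg[OF mh0] by blast+
  have FM: "F T = 0" if "M T = 0" for T
    unfolding F_def up_mass_def
    using up_mass_eq_0_imp[OF fin m0, where T = T] that by (intro sum.neutral) (auto simp: M_def)
  have Fsupp: "F T = (\<Sum>x\<in>{x \<in> set_pmf \<mu>. T \<subseteq> x}. pmf \<nu> x)" for T
    unfolding F_def mh by (rule up_mass_support[OF fin sub]) (use \<nu> in \<open>auto intro!: pmf_eq_0_notin\<close>)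
  define N where "N y = {T \<in> nsets V l. T \<subseteq> y}" for y
  \<comment> \<open>The density of the new law: the average of F / M over the l-subsets of
    y.\<close>
  define h' where "h' y = (\<Sum>T\<in>N y. F T / M T / C)" for y
  have pmf': "pmf \<nu>' y = m y * h' y" for y
  proof -
    have "pmf \<nu>' y = (\<Sum>x\<in>set_pmf \<mu>. pmf (down_up_walk \<mu> k l x) y * pmf \<nu> x)"
      unfolding \<nu>'_def pmf_bind l_def using fins \<nu> by (intro integral_measure_pmf_real) auto
    also have "\<dots> = (\<Sum>x\<in>set_pmf \<mu>. \<Sum>T\<in>nsets V l. if T \<subseteq> x \<and> T \<subseteq> y then pmf \<nu> x * (m y / M T / C) else 0)"
    proof (intro sum.cong refl)
      fix x assume "x \<in> set_pmf \<mu>"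
      then have "pmf (down_up_walk \<mu> k l x) y * pmf \<nu> x =
        (\<Sum>T\<in>{T\<in>nsets V l. T \<subseteq> x \<and> T \<subseteq> y}. pmf \<nu> x * (m y / M T / C))"
        by (simp add: pmf_down_up_walk[OF fin sub _ l] m_def M_def C_def sum_distrib_left sum_divide_distrib mult_ac)
      then show "pmf (down_up_walk \<mu> k l x) y * pmf \<nu> x =
        (\<Sum>T\<in>nsets V l. if T \<subseteq> x \<and> T \<subseteq> y then pmf \<nu> x * (m y / M T / C) else 0)"
        using finl by (simp only: sum.inter_filter)
    qed
    also have "\<dots> = (\<Sum>T\<in>nsets V l. \<Sum>x\<in>set_pmf \<mu>. if T \<subseteq> x \<and> T \<subseteq> y then pmf \<nu> x * (m y / M T / C) else 0)"
      by (rule sum.swap)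
    also have "\<dots> = (\<Sum>T\<in>nsets V l. if T \<subseteq> y then F T * (m y / M T / C) else 0)"
    proof (intro sum.cong refl)
      fix T
      have "F T * (m y / M T / C) = (\<Sum>x\<in>set_pmf \<mu>. if T \<subseteq> x then pmf \<nu> x * (m y / M T / C) else 0)"
        unfolding Fsupp sum_distrib_right using fins by (simp only: sum.inter_filter)
      then show "(\<Sum>x\<in>set_pmf \<mu>. if T \<subseteq> x \<and> T \<subseteq> y then pmf \<nu> x * (m y / M T / C) else 0) =
        (if T \<subseteq> y then F T * (m y / M T / C) else 0)"
        by auto
    qed
    also have "\<dots> = (\<Sum>T\<in>N y. F T * (m y / M T / C))"
      unfolding N_def using finl by (simp only: sum.inter_filter)
    also have "\<dots> = m y * h' y"
      unfolding h'_def sum_distrib_left by (intro sum.cong refl) simp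
    finally show ?thesis .
  qed
  show "set_pmf \<nu>' \<subseteq> set_pmf \<mu>"
    by (auto simp: set_pmf_iff pmf' m_def)
  have "kl_divergence \<nu>' \<mu> = (\<Sum>y\<in>set_pmf \<mu>. m y * (h' y * ln (h' y)))"
    unfolding kl_divergence_def pmf' by (intro sum.cong refl) (simp add: m_def set_pmf_iff)
  also have "\<dots> \<le> (\<Sum>y\<in>set_pmf \<mu>. m y * (\<Sum>T\<in>N y. F T / M T / C * ln (F T / M T)))"
  proof (intro sum_mono mult_left_mono)
    fix y assume y: "y \<in> set_pmf \<mu>"
    have fN: "finite (N y)" using finl by (simp add: N_def)
    have "y \<in> nsets V k" using y sub by blast
    then have "card (N y) = k choose l" unfolding N_def using subsets_of_nset by metis
    then have b: "(\<Sum>T\<in>N y. 1 / C) = 1" using C by (simp add: C_def)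
    have "h' y * ln (h' y / (\<Sum>T\<in>N y. 1 / C)) \<le> (\<Sum>T\<in>N y. F T / M T / C * ln (F T / M T / C / (1 / C)))"
      unfolding h'_def using fN F0 M0 C by (intro log_sum_inequality) auto
    then show "h' y * ln (h' y) \<le> (\<Sum>T\<in>N y. F T / M T / C * ln (F T / M T))"
      unfolding b using C by simp
  qed (simp add: m_def)
  also have "\<dots> = (\<Sum>y\<in>nsets V k. m y * (\<Sum>T\<in>N y. F T / M T / C * ln (F T / M T)))"
    by (rule sum_nsets_support[OF fin sub, symmetric]) (simp add: m_def pmf_eq_0_notin)
  also have "\<dots> = (\<Sum>T\<in>nsets V l. F T / M T / C * ln (F T / M T) * M T)"
    unfolding N_def M_def by (rule sum_up_mass[OF fin finl, symmetric])
  also have "\<dots> = (\<Sum>T\<in>nsets V l. F T * ln (F T / M T) / C)"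
    using FM by (intro sum.cong refl) auto
  also have "\<dots> = level_entropy V k m h l"
    by (simp add: level_entropy_def F_def M_def C_def sum_divide_distrib)
  finally have le: "kl_divergence \<nu>' \<mu> \<le> level_entropy V k m h l" .
  have E: "(\<Sum>S\<in>nsets V k. m S * h S * ln (h S)) = kl_divergence \<nu> \<mu>"
    unfolding kl_divergence_def mh unfolding h_def m_def using \<nu>
    by (intro sum_nsets_support[OF fin sub]) (auto simp: pmf_eq_0_notin)
  have "(\<Sum>S\<in>nsets V k. m S) = 1" "(\<Sum>S\<in>nsets V k. m S * h S) = 1"
    unfolding mh using fin sub \<nu>
    by (auto simp: m_def finite_imp_finite_nsets intro!: sum_pmf_eq_1)
  then have "level_entropy V k m h 0 = 0" by (simp add: level_entropy_0)
  then have "exp (- (1 / \<alpha>)) * k powr (- (1 / \<alpha>)) * kl_divergence \<nu> \<mu> \<le> kl_divergence \<nu> \<mu> - level_entropy V k m h l"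
    using level_entropy_contraction[OF fin \<alpha> m0 _ h0 r] st unfolding E by (simp add: l_def m_def)
  with le show "kl_divergence \<nu>' \<mu> \<le> (1 - exp (- (1 / \<alpha>)) * k powr (- (1 / \<alpha>))) * kl_divergence \<nu> \<mu>"
    by (simp add: algebra_simps)
qed

subsection \<open>Mixing time\<close>

lemma hellinger_le_kl_divergence:
  assumes fin: "finite (set_pmf \<mu>)" and \<nu>: "set_pmf \<nu> \<subseteq> set_pmf \<mu>"
  shows "(\<Sum>x\<in>set_pmf \<mu>. (sqrt (pmf \<nu> x) - sqrt (pmf \<mu> x))\<^sup>2) \<le> kl_divergence \<nu> \<mu>"
proof -
  have n1: "(\<Sum>x\<in>set_pmf \<mu>. pmf \<nu> x) = 1" and m1: "(\<Sum>x\<in>set_pmf \<mu>. pmf \<mu> x) = 1"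
    using fin \<nu> by (auto intro: sum_pmf_eq_1)
  have "(sqrt (pmf \<nu> x) - sqrt (pmf \<mu> x))\<^sup>2 - pmf \<mu> x + pmf \<nu> x \<le> pmf \<nu> x * ln (pmf \<nu> x / pmf \<mu> x)"
    if x: "x \<in> set_pmf \<mu>" for x
  proof -
    define a where "a = sqrt (pmf \<nu> x)"
    define b where "b = sqrt (pmf \<mu> x)"
    have ab: "pmf \<nu> x = a\<^sup>2" "pmf \<mu> x = b\<^sup>2" "0 \<le> a" "0 < b"
      using x by (auto simp: a_def b_def pmf_positive)
    have "a - b \<le> a * ln (a / b)" using ab by (intro mult_ln_div_ge) auto
    \<comment> \<open>2 a (a - b) = (a - b)^2 + a^2 - b^2, and the last two terms cancel in the sum
      because both laws have mass 1.\<close>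
    then have "2 * a * (a - b) \<le> 2 * a * (a * ln (a / b))" using ab by (intro mult_left_mono) auto
    also have "\<dots> = a\<^sup>2 * ln ((a / b)\<^sup>2)"
      using ab by (cases "a = 0") (simp_all add: ln_realpow power2_eq_square[of a])
    finally show ?thesis
      unfolding a_def[symmetric] b_def[symmetric] unfolding ab by (simp add: power_divide power2_eq_square algebra_simps)
  qed
  then have "(\<Sum>x\<in>set_pmf \<mu>. (sqrt (pmf \<nu> x) - sqrt (pmf \<mu> x))\<^sup>2 - pmf \<mu> x + pmf \<nu> x) \<le> kl_divergence \<nu> \<mu>"
    unfolding kl_divergence_def by (rule sum_mono)
  then show ?thesis by (simp add: sum.distrib sum_subtractf n1 m1)
qed

lemma kl_divergence_nonneg:
  assumes "finite (set_pmf \<mu>)" "set_pmf \<nu> \<subseteq> set_pmf \<mu>"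
  shows "0 \<le> kl_divergence \<nu> \<mu>"
  using hellinger_le_kl_divergence[OF assms] by (rule order_trans[rotated]) (simp add: sum_nonneg)

lemma tv_dist_leI:
  assumes "\<And>A. \<bar>measure_pmf.prob p A - measure_pmf.prob q A\<bar> \<le> c"
  shows "tv_dist p q \<le> c"
  unfolding tv_dist_def by (rule cSUP_least) (use assms in auto)

text \<open>A weak form of Pinsker's inequality, through the Hellinger distance.\<close>

lemma tv_dist_le_sqrt_kl:
  assumes fin: "finite (set_pmf \<mu>)" and \<nu>: "set_pmf \<nu> \<subseteq> set_pmf \<mu>"
  shows "tv_dist \<nu> \<mu> \<le> 2 * sqrt (kl_divergence \<nu> \<mu>)"
proof (rule tv_dist_leI)
  fix A
  define a where "a x = sqrt (pmf \<nu> x)" for x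
  define b where "b x = sqrt (pmf \<mu> x)" for x
  let ?S = "set_pmf \<mu>"
  have a: "pmf \<nu> x = (a x)\<^sup>2" "0 \<le> a x" and b: "pmf \<mu> x = (b x)\<^sup>2" "0 \<le> b x" for x
    by (simp_all add: a_def b_def)
  have n1: "(\<Sum>x\<in>?S. (a x)\<^sup>2) = 1" and m1: "(\<Sum>x\<in>?S. (b x)\<^sup>2) = 1"
    using fin \<nu> by (auto simp: sum_pmf_eq_1 simp flip: a b)
  have "measure_pmf.prob \<nu> A = measure_pmf.prob \<nu> (A \<inter> ?S)"
    using \<nu> by (intro measure_pmf.finite_measure_eq_AE) (auto simp: AE_measure_pmf_iff)
  moreover have "measure_pmf.prob \<mu> A = measure_pmf.prob \<mu> (A \<inter> ?S)"
    by (rule measure_Int_set_pmf[symmetric])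
  ultimately have "\<bar>measure_pmf.prob \<nu> A - measure_pmf.prob \<mu> A\<bar> = \<bar>\<Sum>x\<in>A \<inter> ?S. pmf \<nu> x - pmf \<mu> x\<bar>"
    using fin by (simp add: measure_measure_pmf_finite sum_subtractf)
  also have "\<dots> \<le> (\<Sum>x\<in>A \<inter> ?S. \<bar>pmf \<nu> x - pmf \<mu> x\<bar>)" by (rule sum_abs)
  also have "\<dots> \<le> (\<Sum>x\<in>?S. \<bar>pmf \<nu> x - pmf \<mu> x\<bar>)"
    using fin by (intro sum_mono2) auto
  also have "\<dots> = (\<Sum>x\<in>?S. \<bar>a x - b x\<bar> * (a x + b x))"
  proof (intro sum.cong refl)
    fix x
    have "pmf \<nu> x - pmf \<mu> x = (a x - b x) * (a x + b x)" by (simp add: a b power2_eq_square algebra_simps)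
    then show "\<bar>pmf \<nu> x - pmf \<mu> x\<bar> = \<bar>a x - b x\<bar> * (a x + b x)" using a(2) b(2) by (simp add: abs_mult)
  qed
  finally have "\<bar>measure_pmf.prob \<nu> A - measure_pmf.prob \<mu> A\<bar>\<^sup>2 \<le> (\<Sum>x\<in>?S. \<bar>a x - b x\<bar> * (a x + b x))\<^sup>2"
    by (intro power_mono) auto
  also have "\<dots> \<le> (\<Sum>x\<in>?S. \<bar>a x - b x\<bar>\<^sup>2) * (\<Sum>x\<in>?S. (a x + b x)\<^sup>2)"
    by (rule Cauchy_Schwarz_ineq_sum)
  also have "\<dots> \<le> kl_divergence \<nu> \<mu> * 4"
  proof (intro mult_mono)
    show "(\<Sum>x\<in>?S. \<bar>a x - b x\<bar>\<^sup>2) \<le> kl_divergence \<nu> \<mu>"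
      using hellinger_le_kl_divergence[OF assms] by (simp add: a_def b_def)
    have "(a x + b x)\<^sup>2 \<le> 2 * (a x)\<^sup>2 + 2 * (b x)\<^sup>2" for x
      using sum_squares_bound[of "a x" "b x"] by (simp add: power2_sum)
    then have "(\<Sum>x\<in>?S. (a x + b x)\<^sup>2) \<le> (\<Sum>x\<in>?S. 2 * (a x)\<^sup>2 + 2 * (b x)\<^sup>2)" by (rule sum_mono)
    then show "(\<Sum>x\<in>?S. (a x + b x)\<^sup>2) \<le> 4"
      by (simp add: sum.distrib n1 m1 flip: sum_distrib_left)
  qed (auto intro: sum_nonneg kl_divergence_nonneg[OF assms])
  also have "\<dots> = (2 * sqrt (kl_divergence \<nu> \<mu>))\<^sup>2"
    using kl_divergence_nonneg[OF assms] by (simp add: power_mult_distrib)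
  finally show "\<bar>measure_pmf.prob \<nu> A - measure_pmf.prob \<mu> A\<bar> \<le> 2 * sqrt (kl_divergence \<nu> \<mu>)"
    by (rule power2_le_imp_le) (simp add: kl_divergence_nonneg[OF assms])
qed

section \<open>Mixing time from entropy decay\<close>

text \<open>For the case of zero steps: the claimed time bound can be below 1 when the starting mass
  and epsilon are both close to 1.\<close>

lemma tv_dist_return: "tv_dist (return_pmf x) \<mu> \<le> 1 - pmf \<mu> x"
proof (rule tv_dist_leI)
  fix A
  have le: "measure_pmf.prob \<mu> B \<le> 1 - pmf \<mu> x" if "x \<notin> B" for B
  proof -
    have "measure_pmf.prob \<mu> B \<le> measure_pmf.prob \<mu> (- {x})"
      using that by (intro measure_pmf.finite_measure_mono) auto
    also have "\<dots> = 1 - pmf \<mu> x"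
      using measure_pmf.prob_compl[of "{x}" \<mu>] by (simp add: Compl_eq_Diff_UNIV measure_pmf_single)
    finally show ?thesis .
  qed
  show "\<bar>measure_pmf.prob (return_pmf x) A - measure_pmf.prob \<mu> A\<bar> \<le> 1 - pmf \<mu> x"
  proof (cases "x \<in> A")
    case True
    then have "measure_pmf.prob \<mu> (- A) \<le> 1 - pmf \<mu> x" by (intro le) auto
    then show ?thesis
      using True measure_pmf.prob_compl[of A \<mu>]
      by (simp add: Compl_eq_Diff_UNIV measure_return_pmf)
  next
    case False
    then show ?thesis using le[OF False] by (simp add: measure_return_pmf)
  qed
qed

lemma mixing_time_le:
  assumes "tv_dist (law_after P x t) \<mu> \<le> \<epsilon>"
  shows "ereal_of_enat (mixing_time \<mu> P x \<epsilon>) \<le> ereal (real t)"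
proof -
  have "mixing_time \<mu> P x \<epsilon> \<le> enat t"
    unfolding mixing_time_def using assms by (intro Inf_lower) auto
  then have "ereal_of_enat (mixing_time \<mu> P x \<epsilon>) \<le> ereal_of_enat (enat t)"
    by (simp only: ereal_of_enat_le_iff)
  then show ?thesis by simp
qed

lemma mixing_time_bound:
  assumes fin: "finite (set_pmf \<mu>)" and x: "x \<in> set_pmf \<mu>"
    and \<kappa>: "0 < \<kappa>" "\<kappa> \<le> 1" and \<epsilon>: "0 < \<epsilon>" "\<epsilon> < 1"
    and contr: "\<And>\<nu>. set_pmf \<nu> \<subseteq> set_pmf \<mu> \<Longrightarrow> set_pmf (bind_pmf \<nu> P) \<subseteq> set_pmf \<mu> \<and>
      kl_divergence (bind_pmf \<nu> P) \<mu> \<le> (1 - \<kappa>) * kl_divergence \<nu> \<mu>"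
  shows "ereal_of_enat (mixing_time \<mu> P x \<epsilon>)
    \<le> ereal (6 / \<kappa> * (ln (1 + ln (1 / pmf \<mu> x)) + ln (1 / \<epsilon>)))"
proof -
  define p where "p = pmf \<mu> x"
  define X where "X = ln (1 + ln (1 / p)) + ln (1 / \<epsilon>)"
  have p: "0 < p" "p \<le> 1" using x by (auto simp: p_def pmf_positive pmf_le_1)
  have lnp: "1 - p \<le> ln (1 / p)" using ln_le_minus_one[of p] p by (simp add: ln_div)
  have X0: "0 \<le> X" using p lnp \<epsilon> by (simp add: X_def)
  show ?thesis
  proof (cases "1 - p \<le> \<epsilon>")
    case True
    then have "tv_dist (law_after P x 0) \<mu> \<le> \<epsilon>"
      using tv_dist_return[of x \<mu>] by (simp add: law_after_def p_def)
    then have "ereal_of_enat (mixing_time \<mu> P x \<epsilon>) \<le> ereal (real 0)"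
      by (rule mixing_time_le)
    also have "\<dots> \<le> ereal (6 / \<kappa> * X)" using X0 \<kappa> by simp
    finally show ?thesis by (simp add: X_def p_def)
  next
    case False
    have X_eq: "X = ln ((1 + ln (1 / p)) / \<epsilon>)"
      using p lnp \<epsilon> by (simp add: X_def ln_div[of "1 + ln (1 / p)" \<epsilon>] ln_div[of 1 \<epsilon>])
    \<comment> \<open>From epsilon < 1 - p <= ln (1 / p) and epsilon < 1. The resulting X >= ln 2
      absorbs the factor from Pinsker's inequality and the rounding of t.\<close>
    have "2 * \<epsilon> \<le> 1 + ln (1 / p)" using False lnp \<epsilon> p by linarith
    then have "2 \<le> (1 + ln (1 / p)) / \<epsilon>" using \<epsilon> by (simp add: field_simps)
    then have X2: "ln 2 \<le> X" unfolding X_eq by (subst ln_le_cancel_iff) auto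
    \<comment> \<open>4 X >= 2 X + 2 ln 2, so exp (- kappa t) is at most (epsilon / (2 (1 + ln (1 /
      p))))^2; this beats the initial relative entropy ln (1 / p) and leaves (epsilon /
      2)^2.\<close>
    define t where "t = nat \<lceil>4 * X / \<kappa>\<rceil>"
    have t1: "4 * X / \<kappa> \<le> real t" by (simp add: t_def real_nat_ceiling_ge)
    have law: "set_pmf (law_after P x s) \<subseteq> set_pmf \<mu> \<and>
      kl_divergence (law_after P x s) \<mu> \<le> exp (- \<kappa> * s) * ln (1 / p)" for s
    proof (induction s)
      case 0
      have "kl_divergence (return_pmf x) \<mu> = (\<Sum>y\<in>set_pmf \<mu>. if y = x then ln (1 / p) else 0)"
        unfolding kl_divergence_def by (intro sum.cong refl) (auto simp: p_def)
      also have "\<dots> = ln (1 / p)" using fin x by simp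
      finally show ?case using x by (simp add: law_after_def)
    next
      case (Suc s)
      let ?\<nu> = "law_after P x s"
      have eq: "law_after P x (Suc s) = bind_pmf ?\<nu> P" by (simp add: law_after_def)
      have "1 - \<kappa> \<le> exp (- \<kappa>)" using exp_ge_add_one_self[of "- \<kappa>"] by simp
      have "kl_divergence (bind_pmf ?\<nu> P) \<mu> \<le> (1 - \<kappa>) * kl_divergence ?\<nu> \<mu>"
        using contr Suc.IH by blast
      also have "\<dots> \<le> exp (- \<kappa>) * kl_divergence ?\<nu> \<mu>"
        using \<open>1 - \<kappa> \<le> _\<close> kl_divergence_nonneg[OF fin, of ?\<nu>] Suc.IH by (intro mult_right_mono) auto
      also have "\<dots> \<le> exp (- \<kappa>) * (exp (- \<kappa> * s) * ln (1 / p))"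
        using Suc.IH by (intro mult_left_mono) auto
      also have "\<dots> = exp (- \<kappa> * Suc s) * ln (1 / p)"
        by (simp add: algebra_simps flip: exp_add)
      finally show ?case using contr Suc.IH unfolding eq by blast
    qed
    have "2 * X + 2 * ln 2 \<le> \<kappa> * real t"
      using t1 \<kappa> X2 by (simp add: field_simps)
    then have "exp (- \<kappa> * t) \<le> exp (- (2 * X + 2 * ln 2))" by simp
    also have "\<dots> = (exp (- X))\<^sup>2 * (exp (- ln 2))\<^sup>2"
      by (simp add: power2_eq_square flip: exp_add)
    also have "exp (- X) = \<epsilon> / (1 + ln (1 / p))"
    proof -
      have "0 < (1 + ln (1 / p)) / \<epsilon>" using p lnp \<epsilon> by (intro divide_pos_pos) linarith+
      then show ?thesis unfolding X_eq exp_minus by simp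
    qed
    also have "exp (- ln 2) = (1 / 2 :: real)" by (simp add: exp_minus inverse_eq_divide)
    finally have e: "exp (- \<kappa> * t) \<le> (\<epsilon> / (1 + ln (1 / p)))\<^sup>2 * (1 / 2)\<^sup>2" .
    have l0: "0 \<le> ln (1 / p)" using p by simp
    have "kl_divergence (law_after P x t) \<mu> \<le> exp (- \<kappa> * t) * ln (1 / p)" using law by blast
    also have "\<dots> \<le> (\<epsilon> / (1 + ln (1 / p)))\<^sup>2 * (1 / 2)\<^sup>2 * ln (1 / p)"
      using e l0 by (rule mult_right_mono)
    also have "\<dots> = (\<epsilon> / 2)\<^sup>2 * (ln (1 / p) / (1 + ln (1 / p))\<^sup>2)"
      by (simp add: power_divide)
    also have "\<dots> \<le> (\<epsilon> / 2)\<^sup>2 * 1"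
    proof (rule mult_left_mono)
      define L where "L = ln (1 / p)"
      have "0 \<le> L" "L \<le> (1 + L)\<^sup>2" using l0 by (auto simp: L_def power2_eq_square algebra_simps)
      then show "ln (1 / p) / (1 + ln (1 / p))\<^sup>2 \<le> 1"
        unfolding L_def[symmetric] by (simp add: divide_le_eq)
    qed simp
    finally have "sqrt (kl_divergence (law_after P x t) \<mu>) \<le> \<epsilon> / 2"
      using \<epsilon> by (intro real_le_lsqrt) (auto simp: kl_divergence_nonneg[OF fin] law)
    then have "tv_dist (law_after P x t) \<mu> \<le> \<epsilon>"
      using tv_dist_le_sqrt_kl[OF fin, of "law_after P x t"] law by force
    then have "ereal_of_enat (mixing_time \<mu> P x \<epsilon>) \<le> ereal (real t)"
      by (rule mixing_time_le)
    \<comment> \<open>6 = 4 + 2: rounding up costs at most 1 <= 2 X <= 2 X / kappa.\<close>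
    also have "real t \<le> 6 / \<kappa> * X"
    proof -
      have "0 \<le> 4 * X / \<kappa>" using X0 \<kappa> by simp
      then have "real t \<le> 4 * X / \<kappa> + 1" unfolding t_def by linarith
      moreover have "1 \<le> 2 * X" using X2 ln2_ge_two_thirds by linarith
      moreover have "2 * X \<le> 2 * X / \<kappa>" using \<kappa> X0 by (simp add: field_simps mult_left_le)
      moreover have "6 / \<kappa> * X = 4 * X / \<kappa> + 2 * X / \<kappa>" by (simp flip: add_divide_distrib)
      ultimately show ?thesis by linarith
    qed
    finally show ?thesis by (simp add: X_def p_def)
  qed
qed

theorem corollary7:
  fixes \<alpha> :: real
  assumes "0 < \<alpha>" and "\<alpha> \<le> 1"
  shows "\<exists>c C :: real. 0 < c \<and> 0 < C \<and>
    (\<forall>(n :: nat) (k :: nat) (r :: nat) (\<mu> :: nat set pmf).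
       set_pmf \<mu> \<subseteq> nsets {1..n} k \<longrightarrow>
       stable_on n (sector \<alpha>) (gen_poly n k \<mu>) \<longrightarrow>
       r = nat \<lceil>1 / \<alpha>\<rceil> \<longrightarrow> r \<le> k \<longrightarrow>
         ereal (c * real k powr (- (1 / \<alpha>)))
           \<le> mod_log_sobolev_const \<mu> (down_up_walk \<mu> k (k - r))
       \<and> (\<forall>S\<^sub>0\<in>set_pmf \<mu>. \<forall>\<epsilon>::real. 0 < \<epsilon> \<and> \<epsilon> < 1 \<longrightarrow>
            ereal_of_enat (mixing_time \<mu> (down_up_walk \<mu> k (k - r)) S\<^sub>0 \<epsilon>)
              \<le> ereal (C * real k powr (1 / \<alpha>) *
                   (ln (1 + ln (1 / pmf \<mu> S\<^sub>0)) + ln (1 / \<epsilon>)))))"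
proof (rule exI[of _ "exp (- (1 / \<alpha>))"], rule exI[of _ "6 * exp (1 / \<alpha>)"],
    intro conjI allI impI ballI)
  fix n k r :: nat and \<mu> :: "nat set pmf"
  assume sub: "set_pmf \<mu> \<subseteq> nsets {1..n} k" and stable: "stable_on n (sector \<alpha>) (gen_poly n k \<mu>)"
    and r: "r = nat \<lceil>1 / \<alpha>\<rceil>" and rk: "r \<le> k"
  have st: "sector_stable \<alpha> {1..n} k (pmf \<mu>)"
    using stable by (simp add: sector_stable_def stable_on_def gen_poly_def hpoly_def)
  have r1: "1 / \<alpha> \<le> real r" unfolding r by (rule real_nat_ceiling_ge)
  have k1: "1 \<le> real k"
  proof -
    have "0 < 1 / \<alpha>" using assms by simp
    then have "0 < real r" using r1 by linarith
    then show ?thesis using rk by simp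
  qed
  \<comment> \<open>The same kappa bounds the modified log-Sobolev constant and the loss of relative
    entropy per step. The mixing bound uses the latter, as the walk runs in discrete time.\<close>
  define \<kappa> where "\<kappa> = exp (- (1 / \<alpha>)) * real k powr (- (1 / \<alpha>))"
  have "ereal \<kappa> \<le> mod_log_sobolev_const \<mu> (down_up_walk \<mu> k (k - r))"
    unfolding mod_log_sobolev_const_def
  proof (intro Sup_upper CollectI exI[of _ \<kappa>] conjI allI impI refl)
    fix f :: "nat set \<Rightarrow> real"
    assume "\<forall>x\<in>set_pmf \<mu>. 0 < f x"
    then show "\<kappa> * entropy_functional \<mu> f \<le> dirichlet_form \<mu> (down_up_walk \<mu> k (k - r)) f (\<lambda>x. ln (f x))"
      unfolding \<kappa>_def by (intro modified_log_sobolev[OF _ sub assms(1) st r1 rk]) auto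
  qed
  then show "ereal (exp (- (1 / \<alpha>)) * real k powr (- (1 / \<alpha>))) \<le> mod_log_sobolev_const \<mu> (down_up_walk \<mu> k (k - r))"
    by (simp add: \<kappa>_def)
  fix S\<^sub>0 \<epsilon>
  assume S0: "S\<^sub>0 \<in> set_pmf \<mu>" and "0 < \<epsilon> \<and> \<epsilon> < (1::real)"
  then have \<epsilon>: "0 < \<epsilon>" "\<epsilon> < 1" by auto
  have \<kappa>: "0 < \<kappa>" "\<kappa> \<le> 1"
  proof -
    show "0 < \<kappa>" using k1 by (simp add: \<kappa>_def)
    have "exp (- (1 / \<alpha>)) \<le> 1" using assms by simp
    moreover have "real k powr (- (1 / \<alpha>)) \<le> 1"
      using k1 assms powr_mono[of "- (1 / \<alpha>)" 0 "real k"] by simp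
    ultimately show "\<kappa> \<le> 1" unfolding \<kappa>_def by (intro mult_le_one) auto
  qed
  have "6 / \<kappa> = 6 * exp (1 / \<alpha>) * real k powr (1 / \<alpha>)"
    using k1 by (simp add: \<kappa>_def exp_minus powr_minus field_simps)
  moreover have "ereal_of_enat (mixing_time \<mu> (down_up_walk \<mu> k (k - r)) S\<^sub>0 \<epsilon>)
    \<le> ereal (6 / \<kappa> * (ln (1 + ln (1 / pmf \<mu> S\<^sub>0)) + ln (1 / \<epsilon>)))"
  proof (rule mixing_time_bound[OF _ S0 \<kappa> \<epsilon>])
    show "finite (set_pmf \<mu>)" using sub by (rule finite_support[rotated]) simp
    show "set_pmf (bind_pmf \<nu> (down_up_walk \<mu> k (k - r))) \<subseteq> set_pmf \<mu> \<and>
      kl_divergence (bind_pmf \<nu> (down_up_walk \<mu> k (k - r))) \<mu> \<le> (1 - \<kappa>) * kl_divergence \<nu> \<mu>"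
      if "set_pmf \<nu> \<subseteq> set_pmf \<mu>" for \<nu>
      using kl_divergence_contraction[OF _ sub assms(1) st r1 rk that] by (simp add: \<kappa>_def)
  qed
  ultimately show "ereal_of_enat (mixing_time \<mu> (down_up_walk \<mu> k (k - r)) S\<^sub>0 \<epsilon>)
    \<le> ereal (6 * exp (1 / \<alpha>) * real k powr (1 / \<alpha>) * (ln (1 + ln (1 / pmf \<mu> S\<^sub>0)) + ln (1 / \<epsilon>)))"
    by (simp only:)
qed simp_all

end
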